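(* Let $k$ be a field of characteristic $0$, let $G$ be an affine algebraic group over $k$ with Lie algebra $\mathfrak g$, and let $\nabla_i=\partial_i+A_i$, $A_i\in\mathfrak g[[x_1,\dots,x_n]]$, $i=1,\dots,n$, be a connection in the trivial $G$-bundle on the formal disk $\mathfrak D_n=\mathrm{Spf}\,k[[x_1,\dots,x_n]]$, with curvature components $F_{ij}$. Then the set of elements $$\bigl(\nabla_{i_1}\nabla_{i_2}\cdots\nabla_{i_{d-2}}F_{i_{d-1},i_d}\bigr)(0)\in\mathfrak g,\qquad i_1\ge i_2\ge\dots\ge i_{d-1}<i_d,\quad d\ge2,$$ determines $\nabla$ uniquely up to restricted gauge equivalence. Conversely, given any system of elements $$\gamma_{i_1,\dots,i_d}\in\mathfrak g,\qquad i_1\ge i_2\ge\dots\ge i_{d-1}<i_d,\quad d\ge2,$$ there exists a connection $\nabla$ on the trivial $G$-bundle over $\mathfrak D_n$, unique up to restricted gauge equivalence, with $$\bigl(\nabla_{i_1}\nabla_{i_2}\cdots\nabla_{i_{d-2}}F_{i_{d-1},i_d}\bigr)(0)=\gamma_{i_1,\dots,i_d}$$ for all such multi-indices.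
   Context: Indices run over $\{1,\dots,n\}$. The curvature components are $F_{ij}=[\nabla_i,\nabla_j]=\partial_iA_j-\partial_jA_i+[A_i,A_j]\in\mathfrak g[[x_1,\dots,x_n]]$, and the $\nabla_i$ act on $\mathfrak g[[x_1,\dots,x_n]]$ by the adjoint action: $\nabla_i(B)=\partial_iB+[A_i,B]$. For $B\in\mathfrak g[[x_1,\dots,x_n]]$, $B(0)\in\mathfrak g$ denotes the constant term. A gauge transformation is an element $g\in G(k[[x_1,\dots,x_n]])$, acting on connections by $A_i\mapsto g^{-1}A_ig+g^{-1}\partial_ig$. It is *restricted* if its value at $0$ is $1\in G(k)$. Two connections are restricted gauge equivalent if they are related by a restricted gauge transformation. *)

theory Defs
  imports Complex_Main "HOL-Library.Multiset"
begin

section \<open>Formal power series in finitely many variables\<close>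

text \<open>
  The variables are indexed by a finite type \<open>'n\<close>, an exponent is a function \<open>'n \<Rightarrow> nat\<close>, and
  exponents are ordered and subtracted pointwise.
\<close>

typedef ('a, 'n) mfps = "UNIV :: (('n \<Rightarrow> nat) \<Rightarrow> 'a) set"
  morphisms mfps_nth Abs_mfps
  by simp

lemma mfps_nth_Abs [simp]: "mfps_nth (Abs_mfps f) = f"
  by (simp add: Abs_mfps_inverse)

lemma mfps_eqI: "(\<And>m. mfps_nth f m = mfps_nth g m) \<Longrightarrow> f = g"
  by (metis ext mfps_nth_inject)

lemma finite_exponents_le [simp]: "finite {a. a \<le> (m :: 'n::finite \<Rightarrow> nat)}"
proof -
  have "{a. a \<le> m} \<subseteq> {a. \<forall>i. (i \<in> UNIV \<longrightarrow> a i \<in> {..Max (range m)}) \<and> (i \<notin> UNIV \<longrightarrow> a i = 0)}"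
    by (auto simp: le_fun_def) (meson Max_ge finite finite_imageI order_trans rangeI)
  moreover have "finite \<dots>"
    by (rule finite_set_of_finite_funs) auto
  ultimately show ?thesis
    by (rule finite_subset)
qed

instantiation mfps :: (comm_ring_1, finite) comm_ring_1
begin

definition zero_mfps :: "('a, 'b) mfps" where
  "0 = Abs_mfps (\<lambda>m. 0)"

definition one_mfps :: "('a, 'b) mfps" where
  "1 = Abs_mfps (\<lambda>m. if m = (\<lambda>i. 0) then 1 else 0)"

definition plus_mfps :: "('a, 'b) mfps \<Rightarrow> ('a, 'b) mfps \<Rightarrow> ('a, 'b) mfps" where
  "f + g = Abs_mfps (\<lambda>m. mfps_nth f m + mfps_nth g m)"

definition minus_mfps :: "('a, 'b) mfps \<Rightarrow> ('a, 'b) mfps \<Rightarrow> ('a, 'b) mfps" where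
  "f - g = Abs_mfps (\<lambda>m. mfps_nth f m - mfps_nth g m)"

definition uminus_mfps :: "('a, 'b) mfps \<Rightarrow> ('a, 'b) mfps" where
  "- f = Abs_mfps (\<lambda>m. - mfps_nth f m)"

definition times_mfps :: "('a, 'b) mfps \<Rightarrow> ('a, 'b) mfps \<Rightarrow> ('a, 'b) mfps" where
  "f * g = Abs_mfps (\<lambda>m. \<Sum>a | a \<le> m. mfps_nth f a * mfps_nth g (m - a))"

instance
proof
  fix f g h :: "('a, 'b) mfps"
  show "f * g * h = f * (g * h)"
  proof (rule mfps_eqI)
    fix m :: "'b \<Rightarrow> nat"
    let ?F = "mfps_nth f" and ?G = "mfps_nth g" and ?H = "mfps_nth h"
    have "mfps_nth (f * g * h) m =
        (\<Sum>(a, b)\<in>(SIGMA a:{a. a \<le> m}. {b. b \<le> a}). ?F b * ?G (a - b) * ?H (m - a))"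
      by (simp add: times_mfps_def sum_distrib_right sum.Sigma)
    also have "\<dots> =
        (\<Sum>(b, c)\<in>(SIGMA b:{b. b \<le> m}. {c. c \<le> m - b}). ?F b * (?G c * ?H (m - b - c)))"
    proof (rule sum.reindex_bij_witness[where i = "\<lambda>(b, c). (\<lambda>i. b i + c i, b)"
          and j = "\<lambda>(a, b). (b, a - b)"], goal_cases)
      case (1 x)
      then show ?case by (auto simp: le_fun_def fun_eq_iff)
    next
      case (2 x)
      then show ?case by (auto simp: le_fun_def diff_le_mono intro: order_trans)
    next
      case (3 x)
      then show ?case by (auto simp: fun_eq_iff)
    next
      case (4 x)
      then show ?case
        by (auto simp: le_fun_def)
          (metis add.commute add_le_mono le_add_diff_inverse2 nat_add_left_cancel_le)
    next
      case (5 x)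
      then obtain a b where x: "x = (a, b)" and le: "a \<le> m" "b \<le> a"
        by auto
      then have "m - b - (a - b) = m - a"
        by (auto simp: le_fun_def fun_eq_iff)
      then show ?case
        by (simp add: x mult.assoc)
    qed
    also have "\<dots> = mfps_nth (f * (g * h)) m"
      by (simp add: times_mfps_def sum_distrib_left sum.Sigma)
    finally show "mfps_nth (f * g * h) m = mfps_nth (f * (g * h)) m" .
  qed
  show "f * g = g * f"
  proof (rule mfps_eqI)
    fix m :: "'b \<Rightarrow> nat"
    have "m - (m - a) = a" if "a \<le> m" for a
      using that by (auto simp: le_fun_def fun_eq_iff)
    moreover have "m - a \<le> m" for a
      by (simp add: le_fun_def)
    ultimately show "mfps_nth (f * g) m = mfps_nth (g * f) m"
      unfolding times_mfps_def mfps_nth_Abs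
      by (intro sum.reindex_bij_witness[where i = "\<lambda>a. m - a" and j = "\<lambda>a. m - a"])
        (auto simp: mult.commute)
  qed
  show "1 * f = f"
  proof (rule mfps_eqI)
    fix m :: "'b \<Rightarrow> nat"
    have "mfps_nth (1 * f) m =
        (\<Sum>a | a \<le> m. if a = (\<lambda>i. 0) then mfps_nth f (m - a) else 0)"
      unfolding times_mfps_def one_mfps_def mfps_nth_Abs by (rule sum.cong) auto
    also have "\<dots> = mfps_nth f (m - (\<lambda>i. 0))"
      by (subst sum.delta[OF finite_exponents_le]) (simp add: le_fun_def)
    also have "m - (\<lambda>i. 0) = m"
      by (simp add: fun_eq_iff)
    finally show "mfps_nth (1 * f) m = mfps_nth f m" .
  qed
  show "(0 :: ('a, 'b) mfps) \<noteq> 1"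
  proof
    assume "(0 :: ('a, 'b) mfps) = 1"
    then have "mfps_nth (0 :: ('a, 'b) mfps) (\<lambda>i. 0) = mfps_nth 1 (\<lambda>i. 0)"
      by simp
    then show False
      by (simp add: zero_mfps_def one_mfps_def)
  qed
qed (auto intro!: mfps_eqI simp: zero_mfps_def plus_mfps_def minus_mfps_def uminus_mfps_def
      times_mfps_def algebra_simps sum.distrib)

end

definition mfps_const :: "'a \<Rightarrow> ('a::zero, 'n) mfps" where
  "mfps_const c = Abs_mfps (\<lambda>m. if m = (\<lambda>i. 0) then c else 0)"

definition mfps_scale :: "'a::comm_ring_1 \<Rightarrow> ('a, 'n::finite) mfps \<Rightarrow> ('a, 'n) mfps" where
  "mfps_scale c f = mfps_const c * f"

definition mfps_deriv :: "'n \<Rightarrow> ('a::semiring_1, 'n) mfps \<Rightarrow> ('a, 'n) mfps" where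
  "mfps_deriv i f = Abs_mfps (\<lambda>m. of_nat (Suc (m i)) * mfps_nth f (m(i := Suc (m i))))"


section \<open>Affine algebraic groups\<close>

text \<open>
  An affine algebraic group over a field \<open>k\<close> is given by its coordinate ring \<open>H\<close>, a finitely
  generated commutative Hopf algebra over \<open>k\<close> (the carrier is a whole type).

  A finite sum of pure tensors \<open>a\<^sub>1 \<otimes> \<dots> \<otimes> a\<^sub>r\<close> is represented by a multiset of words
  \<open>[a\<^sub>1, \<dots>, a\<^sub>r]\<close>. On words of a fixed length \<open>r \<ge> 1\<close>, the relation below is equality in the
  \<open>r\<close>-fold tensor power of \<open>H\<close> over \<open>k\<close>; additive inverses are \<open>(- a) \<otimes> b\<close>, so sums with
  nonnegative coefficients suffice.
\<close>

inductive tensor_eq :: "('k \<Rightarrow> 'h \<Rightarrow> 'h) \<Rightarrow> 'h::comm_ring_1 list multiset \<Rightarrow> 'h list multiset \<Rightarrow> bool"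
  for scale where
  refl: "tensor_eq scale M M"
| sym: "tensor_eq scale M N \<Longrightarrow> tensor_eq scale N M"
| trans: "tensor_eq scale M N \<Longrightarrow> tensor_eq scale N P \<Longrightarrow> tensor_eq scale M P"
| cong: "tensor_eq scale M N \<Longrightarrow> tensor_eq scale (M + P) (N + P)"
| zero: "tensor_eq scale {#u @ [0] @ v#} {#}"
| add: "tensor_eq scale {#u @ [a + b] @ v#} {#u @ [a] @ v, u @ [b] @ v#}"
| scale: "tensor_eq scale {#u @ [scale c a] @ v @ [b] @ w#} {#u @ [a] @ v @ [scale c b] @ w#}"

definition tensor2_eq ::
    "('k \<Rightarrow> 'h \<Rightarrow> 'h) \<Rightarrow> ('h::comm_ring_1 \<times> 'h) multiset \<Rightarrow> ('h \<times> 'h) multiset \<Rightarrow> bool" where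
  "tensor2_eq scale M N \<longleftrightarrow> tensor_eq scale {#[a, b]. (a, b) \<in># M#} {#[a, b]. (a, b) \<in># N#}"

locale k_algebra = vector_space scale
  for scale :: "'k::field \<Rightarrow> 'h::comm_ring_1 \<Rightarrow> 'h" +
  assumes scale_mult: "scale c a * b = scale c (a * b)"

definition algebra_hom ::
    "('k::field \<Rightarrow> 'a::comm_ring_1 \<Rightarrow> 'a) \<Rightarrow> ('k \<Rightarrow> 'b::comm_ring_1 \<Rightarrow> 'b) \<Rightarrow> ('a \<Rightarrow> 'b) \<Rightarrow> bool" where
  "algebra_hom s1 s2 \<phi> \<longleftrightarrow>
     Vector_Spaces.linear s1 s2 \<phi> \<and> \<phi> 1 = 1 \<and> (\<forall>a b. \<phi> (a * b) = \<phi> a * \<phi> b)"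

definition subalgebra :: "('k::field \<Rightarrow> 'h::comm_ring_1 \<Rightarrow> 'h) \<Rightarrow> 'h set \<Rightarrow> bool" where
  "subalgebra scale B \<longleftrightarrow>
     module.subspace scale B \<and> 1 \<in> B \<and> (\<forall>a\<in>B. \<forall>b\<in>B. a * b \<in> B)"

text \<open>
  The comultiplication chooses a representative of each element of \<open>H \<otimes> H\<close>, and its axioms are
  stated up to equality of tensors. Finite type is the only finiteness condition; in characteristic
  \<open>0\<close> the group scheme is then automatically reduced.
\<close>

locale affine_algebraic_group = k_algebra scale
  for scale :: "'k::field \<Rightarrow> 'h::comm_ring_1 \<Rightarrow> 'h"
    and comult :: "'h \<Rightarrow> ('h \<times> 'h) multiset"
    and counit :: "'h \<Rightarrow> 'k"
    and antipode :: "'h \<Rightarrow> 'h" +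
  assumes finite_type: "\<exists>X. finite X \<and> (\<forall>B. subalgebra scale B \<and> X \<subseteq> B \<longrightarrow> B = UNIV)"
    and comult_add: "tensor2_eq scale (comult (f + g)) (comult f + comult g)"
    and comult_scale: "tensor2_eq scale (comult (scale c f)) {#(scale c a, b). (a, b) \<in># comult f#}"
    and comult_one: "tensor2_eq scale (comult 1) {#(1, 1)#}"
    and comult_mult: "tensor2_eq scale (comult (f * g))
          (\<Sum>(a, b)\<in>#comult f. {#(a * a', b * b'). (a', b') \<in># comult g#})"
    and counit_hom: "algebra_hom scale (*) counit"
    and antipode_hom: "algebra_hom scale scale antipode"
    and coassoc: "tensor_eq scale
          (\<Sum>(a, b)\<in>#comult f. {#[a', a'', b]. (a', a'') \<in># comult a#})
          (\<Sum>(a, b)\<in>#comult f. {#[a, b', b'']. (b', b'') \<in># comult b#})"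
    and counit_left: "(\<Sum>(a, b)\<in>#comult f. scale (counit a) b) = f"
    and counit_right: "(\<Sum>(a, b)\<in>#comult f. scale (counit b) a) = f"
    and antipode_left: "(\<Sum>(a, b)\<in>#comult f. antipode a * b) = scale (counit f) 1"
    and antipode_right: "(\<Sum>(a, b)\<in>#comult f. a * antipode b) = scale (counit f) 1"

text \<open>
  For a commutative \<open>k\<close>-algebra \<open>R\<close>, the \<open>k\<close>-linear maps \<open>H \<rightarrow> R\<close> form an associative \<open>R\<close>-algebra
  under convolution, with unit the composite of the counit and \<open>k \<rightarrow> R\<close>. The group \<open>G(R)\<close> is a
  group of units of this algebra, with inverse \<open>g \<circ> antipode\<close>, and \<open>\<gg> \<otimes> R\<close> is a Lie subalgebra
  for the commutator bracket. For \<open>G = GL\<^sub>N\<close>, evaluation at the matrix of coordinate functions turns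
  convolution products into matrix products, so that the formulas below are the usual matrix formulas.
\<close>

definition conv ::
    "('h \<Rightarrow> ('h \<times> 'h) multiset) \<Rightarrow> ('h \<Rightarrow> 'r) \<Rightarrow> ('h \<Rightarrow> 'r) \<Rightarrow> 'h \<Rightarrow> 'r::comm_ring_1" where
  "conv comult \<phi> \<psi> = (\<lambda>f. \<Sum>(a, b)\<in>#comult f. \<phi> a * \<psi> b)"

definition lie_bracket ::
    "('h \<Rightarrow> ('h \<times> 'h) multiset) \<Rightarrow> ('h \<Rightarrow> 'r) \<Rightarrow> ('h \<Rightarrow> 'r) \<Rightarrow> 'h \<Rightarrow> 'r::comm_ring_1" where
  "lie_bracket comult X Y = (\<lambda>f. conv comult X Y f - conv comult Y X f)"

text \<open>The Lie algebra is the tangent space at the identity: point derivations at the counit.\<close>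

definition lie_algebra ::
    "('k::field \<Rightarrow> 'h::comm_ring_1 \<Rightarrow> 'h) \<Rightarrow> ('h \<Rightarrow> 'k) \<Rightarrow> ('h \<Rightarrow> 'k) set" where
  "lie_algebra scale counit =
     {X. Vector_Spaces.linear scale (*) X \<and>
         (\<forall>a b. X (a * b) = X a * counit b + counit a * X b)}"


section \<open>Connections on the formal disk\<close>

text \<open>
  A power series \<open>\<Sum>\<^sub>m X\<^sub>m x\<^sup>m\<close> with coefficients \<open>X\<^sub>m : H \<rightarrow> k\<close> is represented by the map
  \<open>f \<mapsto> \<Sum>\<^sub>m X\<^sub>m(f) x\<^sup>m\<close> from \<open>H\<close> to the ring of power series.
\<close>

definition coefficient :: "('h \<Rightarrow> ('k, 'n) mfps) \<Rightarrow> ('n \<Rightarrow> nat) \<Rightarrow> 'h \<Rightarrow> 'k" where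
  "coefficient B m = (\<lambda>f. mfps_nth (B f) m)"

definition value_at_0 :: "('h \<Rightarrow> ('k, 'n) mfps) \<Rightarrow> 'h \<Rightarrow> 'k" where
  "value_at_0 B = coefficient B (\<lambda>i. 0)"

definition partial :: "'n \<Rightarrow> ('h \<Rightarrow> ('k::semiring_1, 'n) mfps) \<Rightarrow> 'h \<Rightarrow> ('k, 'n) mfps" where
  "partial i B = (\<lambda>f. mfps_deriv i (B f))"

definition lie_series ::
    "('k::field \<Rightarrow> 'h::comm_ring_1 \<Rightarrow> 'h) \<Rightarrow> ('h \<Rightarrow> 'k) \<Rightarrow> ('h \<Rightarrow> ('k, 'n) mfps) set" where
  "lie_series scale counit = {B. \<forall>m. coefficient B m \<in> lie_algebra scale counit}"

text \<open>The connection with components \<open>\<nabla>\<^sub>i = \<partial>\<^sub>i + A i\<close> is represented by \<open>A\<close>.\<close>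

definition connections ::
    "('k::field \<Rightarrow> 'h::comm_ring_1 \<Rightarrow> 'h) \<Rightarrow> ('h \<Rightarrow> 'k) \<Rightarrow> ('n \<Rightarrow> 'h \<Rightarrow> ('k, 'n) mfps) set" where
  "connections scale counit = {A. \<forall>i. A i \<in> lie_series scale counit}"

definition curvature ::
    "('h \<Rightarrow> ('h \<times> 'h) multiset) \<Rightarrow> ('n \<Rightarrow> 'h \<Rightarrow> ('k::comm_ring_1, 'n::finite) mfps) \<Rightarrow>
     'n \<Rightarrow> 'n \<Rightarrow> 'h \<Rightarrow> ('k, 'n) mfps" where
  "curvature comult A i j =
     (\<lambda>f. partial i (A j) f - partial j (A i) f + lie_bracket comult (A i) (A j) f)"

definition covariant_deriv ::
    "('h \<Rightarrow> ('h \<times> 'h) multiset) \<Rightarrow> ('n \<Rightarrow> 'h \<Rightarrow> ('k::comm_ring_1, 'n::finite) mfps) \<Rightarrow>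
     'n \<Rightarrow> ('h \<Rightarrow> ('k, 'n) mfps) \<Rightarrow> 'h \<Rightarrow> ('k, 'n) mfps" where
  "covariant_deriv comult A i B = (\<lambda>f. partial i B f + lie_bracket comult (A i) B f)"

text \<open>
  A multi-index \<open>(i\<^sub>1, \<dots>, i\<^sub>d)\<close> is the list \<open>I = [i\<^sub>1, \<dots>, i\<^sub>d]\<close>; list positions are counted from
  \<open>0\<close>, so \<open>i\<^sub>d\<^sub>-\<^sub>1 = I ! (d - 2)\<close> and \<open>i\<^sub>d = I ! (d - 1)\<close>.
\<close>

definition admissible :: "'n::linorder list \<Rightarrow> bool" where
  "admissible I \<longleftrightarrow>
     (let d = length I in
        d \<ge> 2 \<and> sorted_wrt (\<ge>) (take (d - 1) I) \<and> I ! (d - 2) < I ! (d - 1))"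

definition curvature_jet ::
    "('h \<Rightarrow> ('h \<times> 'h) multiset) \<Rightarrow> ('n \<Rightarrow> 'h \<Rightarrow> ('k::comm_ring_1, 'n::finite) mfps) \<Rightarrow>
     'n list \<Rightarrow> 'h \<Rightarrow> 'k" where
  "curvature_jet comult A I =
     (let d = length I in
        value_at_0 (foldr (covariant_deriv comult A) (take (d - 2) I)
          (curvature comult A (I ! (d - 2)) (I ! (d - 1)))))"

definition gauge_group ::
    "('k::field \<Rightarrow> 'h::comm_ring_1 \<Rightarrow> 'h) \<Rightarrow> ('h \<Rightarrow> ('k, 'n::finite) mfps) set" where
  "gauge_group scale = {g. algebra_hom scale mfps_scale g}"

text \<open>The action \<open>A\<^sub>i \<mapsto> g\<^sup>-\<^sup>1 A\<^sub>i g + g\<^sup>-\<^sup>1 \<partial>\<^sub>i g\<close>.\<close>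

definition gauge_transform ::
    "('h \<Rightarrow> ('h \<times> 'h) multiset) \<Rightarrow> ('h \<Rightarrow> 'h) \<Rightarrow> ('h \<Rightarrow> ('k::comm_ring_1, 'n::finite) mfps) \<Rightarrow>
     ('n \<Rightarrow> 'h \<Rightarrow> ('k, 'n) mfps) \<Rightarrow> 'n \<Rightarrow> 'h \<Rightarrow> ('k, 'n) mfps" where
  "gauge_transform comult antipode g A i =
     (\<lambda>f. conv comult (conv comult (g \<circ> antipode) (A i)) g f
        + conv comult (g \<circ> antipode) (partial i g) f)"

text \<open>The identity element of \<open>G(k)\<close> is the counit.\<close>

definition restricted_gauge_equivalent ::
    "('k::field \<Rightarrow> 'h::comm_ring_1 \<Rightarrow> 'h) \<Rightarrow> ('h \<Rightarrow> ('h \<times> 'h) multiset) \<Rightarrow> ('h \<Rightarrow> 'k) \<Rightarrow> ('h \<Rightarrow> 'h) \<Rightarrow>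
     ('n::finite \<Rightarrow> 'h \<Rightarrow> ('k, 'n) mfps) \<Rightarrow> ('n \<Rightarrow> 'h \<Rightarrow> ('k, 'n) mfps) \<Rightarrow> bool" where
  "restricted_gauge_equivalent scale comult counit antipode A A' \<longleftrightarrow>
     (\<exists>g\<in>gauge_group scale. value_at_0 g = counit \<and> A' = gauge_transform comult antipode g A)"

end

theory Submission
  imports Defs "HOL-Library.Function_Algebras"
begin

text \<open>
  Every connection is restricted gauge equivalent to one in the complete axial gauge, where \<open>A\<^sub>i\<close>
  vanishes on the subspace \<open>x\<^sub>1 = \<dots> = x\<^sub>i\<^sub>-\<^sub>1 = 0\<close>. For such a connection, evaluate a curvature jet with
  \<open>i\<^sub>1 \<ge> \<dots> \<ge> i\<^sub>d\<^sub>-\<^sub>1 < i\<^sub>d\<close> at \<open>0\<close> from the outside in: each \<open>\<nabla>\<^sub>i\<close> is needed only on the subspace where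
  all variables of smaller index vanish, and there it is \<open>\<partial>\<^sub>i\<close>. The innermost \<open>F\<^sub>i\<^sub>j\<close> is likewise
  \<open>\<partial>\<^sub>i A\<^sub>j\<close> there. So the jet is a nonzero multiple of the coefficient of \<open>x\<^sub>i\<^sub>1 \<cdots> x\<^sub>i\<^sub>d\<^sub>-\<^sub>1\<close> in \<open>A\<^sub>i\<^sub>d\<close>,
  and every coefficient that is not killed by the gauge condition arises exactly once.
\<close>

section \<open>Power series\<close>

lemma mfps_nth_add [simp]: "mfps_nth (f + g) m = mfps_nth f m + mfps_nth g m"
  by (simp add: plus_mfps_def)

lemma mfps_nth_diff [simp]: "mfps_nth (f - g) m = mfps_nth f m - mfps_nth g m"
  by (simp add: minus_mfps_def)

lemma mfps_nth_zero [simp]: "mfps_nth 0 m = 0"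
  by (simp add: zero_mfps_def)

lemma mfps_nth_one: "mfps_nth 1 m = (if m = (\<lambda>i. 0) then 1 else 0)"
  by (simp add: one_mfps_def)

lemma mfps_nth_mult: "mfps_nth (f * g) m = (\<Sum>a | a \<le> m. mfps_nth f a * mfps_nth g (m - a))"
  by (simp add: times_mfps_def)

lemma mfps_nth_sum_mset [simp]: "mfps_nth (\<Sum>\<^sub># M) m = (\<Sum>x\<in>#M. mfps_nth x m)"
  by (induction M) auto

lemma mfps_nth_deriv [simp]:
  "mfps_nth (mfps_deriv i f) m = of_nat (Suc (m i)) * mfps_nth f (m(i := Suc (m i)))"
  by (simp add: mfps_deriv_def)

lemma mfps_nth_const_mult [simp]: "mfps_nth (mfps_const c * f) m = c * mfps_nth f m"
proof -
  have "mfps_nth (mfps_const c * f) m = (\<Sum>a | a \<le> m. if a = (\<lambda>i. 0) then c * mfps_nth f (m - a) else 0)"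
    unfolding mfps_nth_mult mfps_const_def mfps_nth_Abs by (rule sum.cong) auto
  also have "\<dots> = c * mfps_nth f (m - (\<lambda>i. 0))"
    by (subst sum.delta[OF finite_exponents_le]) (simp add: le_fun_def)
  also have "m - (\<lambda>i. 0) = m"
    by (simp add: fun_eq_iff)
  finally show ?thesis .
qed

lemma mfps_nth_mult_0: "mfps_nth (f * g) (\<lambda>i. 0) = mfps_nth f (\<lambda>i. 0) * mfps_nth g (\<lambda>i. 0)"
proof -
  have "{a. a \<le> (\<lambda>i. 0)} = {(\<lambda>i::'b. 0 :: nat)}"
    by (auto simp: le_fun_def)
  moreover have "(\<lambda>i::'b. 0 :: nat) - (\<lambda>i. 0) = (\<lambda>i. 0)"
    by (simp add: fun_eq_iff)
  ultimately show ?thesis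
    by (simp add: mfps_nth_mult)
qed

lemma mfps_nth_const: "mfps_nth (mfps_const c) m = (if m = (\<lambda>i. 0) then c else 0)"
  by (simp add: mfps_const_def)

lemma mfps_const_1 [simp]: "mfps_const 1 = (1 :: ('a::comm_ring_1, 'n::finite) mfps)"
  by (rule mfps_eqI) (simp add: mfps_nth_const mfps_nth_one)

lemma mfps_const_mult: "mfps_const (c * d) = (mfps_const c * mfps_const d :: ('a::comm_ring_1, 'n::finite) mfps)"
  by (rule mfps_eqI) (simp add: mfps_nth_const)

lemma mfps_const_add: "mfps_const (c + d) = (mfps_const c + mfps_const d :: ('a::comm_ring_1, 'n::finite) mfps)"
  by (rule mfps_eqI) (simp add: mfps_nth_const)

lemma mfps_deriv_add [simp]:
  "mfps_deriv i (f + g) = mfps_deriv i f + (mfps_deriv i g :: ('a::comm_ring_1, 'n::finite) mfps)"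
  by (rule mfps_eqI) (simp add: algebra_simps)

lemma mfps_deriv_diff [simp]:
  "mfps_deriv i (f - g) = mfps_deriv i f - (mfps_deriv i g :: ('a::comm_ring_1, 'n::finite) mfps)"
  by (rule mfps_eqI) (simp add: algebra_simps)

lemma mfps_deriv_zero [simp]: "mfps_deriv i 0 = (0 :: ('a::comm_ring_1, 'n::finite) mfps)"
  by (rule mfps_eqI) simp

lemma mfps_deriv_const [simp]: "mfps_deriv i (mfps_const c) = (0 :: ('a::comm_ring_1, 'n::finite) mfps)"
  by (rule mfps_eqI) (auto simp: mfps_nth_const fun_eq_iff)

lemma mfps_deriv_sum_mset:
  "mfps_deriv i (\<Sum>\<^sub># M) = (\<Sum>x\<in>#M. mfps_deriv i x :: ('a::comm_ring_1, 'n::finite) mfps)"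
  by (induction M) auto

lemma mfps_deriv_commute:
  "mfps_deriv i (mfps_deriv j f) = mfps_deriv j (mfps_deriv i (f :: ('a::comm_ring_1, 'n::finite) mfps))"
  by (rule mfps_eqI) (cases "i = j"; simp add: fun_upd_twist mult.left_commute)

text \<open>In the coefficient of f g at m' = m + e_i, the factor m i + 1 is split as a i + (m i + 1
  - a i). The first part differentiates f and the second differentiates g.\<close>

lemma mfps_deriv_mult:
  fixes f g :: "('a::comm_ring_1, 'n::finite) mfps"
  shows "mfps_deriv i (f * g) = mfps_deriv i f * g + f * mfps_deriv i g"
proof (rule mfps_eqI)
  fix m :: "'n \<Rightarrow> nat"
  define m' where "m' = m(i := Suc (m i))"
  define F where "F a = mfps_nth f a * mfps_nth g (m' - a)" for a
  have "mfps_nth (mfps_deriv i (f * g)) m = (\<Sum>a | a \<le> m'. of_nat (Suc (m i)) * F a)"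
    by (simp add: mfps_nth_mult sum_distrib_left F_def m'_def)
  also have "\<dots> = (\<Sum>a | a \<le> m'. of_nat (a i) * F a + of_nat (Suc (m i) - a i) * F a)"
  proof (rule sum.cong[OF HOL.refl])
    fix a assume "a \<in> {a. a \<le> m'}"
    then have "a i \<le> Suc (m i)"
      by (auto simp: m'_def le_fun_def dest: spec[of _ i])
    then have "of_nat (Suc (m i)) = (of_nat (a i) + of_nat (Suc (m i) - a i) :: 'a)"
      by (metis le_add_diff_inverse of_nat_add)
    then show "of_nat (Suc (m i)) * F a = of_nat (a i) * F a + of_nat (Suc (m i) - a i) * F a"
      by (simp add: distrib_right)
  qed
  also have "\<dots> = (\<Sum>a | a \<le> m'. of_nat (a i) * F a) + (\<Sum>a | a \<le> m'. of_nat (Suc (m i) - a i) * F a)"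
    by (rule sum.distrib)
  \<comment> \<open>Terms with a i = 0 carry the factor 0. Dropping them makes lowering the i-th
    exponent by one a bijection onto the exponents below m.\<close>
  also have "(\<Sum>a | a \<le> m'. of_nat (a i) * F a) = (\<Sum>a | a \<le> m' \<and> a i \<noteq> 0. of_nat (a i) * F a)"
    by (rule sum.mono_neutral_right) (auto intro: finite_subset[OF _ finite_exponents_le[of m']])
  also have "\<dots> = (\<Sum>b | b \<le> m. of_nat (Suc (b i)) * F (b(i := Suc (b i))))"
  proof (rule sum.reindex_bij_witness[where i = "\<lambda>b. b(i := Suc (b i))" and j = "\<lambda>a. a(i := a i - 1)"])
    fix a assume a: "a \<in> {a. a \<le> m' \<and> a i \<noteq> 0}"
    then have "a i \<le> Suc (m i)" "\<And>l. l \<noteq> i \<Longrightarrow> a l \<le> m l"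
      by (auto simp: m'_def le_fun_def split: if_splits dest: spec[of _ i])
    then show "a(i := a i - 1) \<in> {b. b \<le> m}"
      by (simp add: le_fun_def)
  qed (auto simp: m'_def le_fun_def)
  also have "\<dots> = mfps_nth (mfps_deriv i f * g) m"
  proof -
    have "m' - b(i := Suc (b i)) = m - b" for b
      by (auto simp: m'_def fun_eq_iff)
    then show ?thesis
      by (simp add: mfps_nth_mult F_def mult.assoc)
  qed
  \<comment> \<open>The exponents below m' but not below m have a i = m i + 1, where the truncated
    difference is 0.\<close>
  also have "(\<Sum>a | a \<le> m'. of_nat (Suc (m i) - a i) * F a) = (\<Sum>a | a \<le> m. of_nat (Suc (m i) - a i) * F a)"
  proof (rule sum.mono_neutral_right)
    show "{a. a \<le> m} \<subseteq> {a. a \<le> m'}"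
      by (auto simp: m'_def le_fun_def intro: le_SucI)
    show "\<forall>a\<in>{a. a \<le> m'} - {a. a \<le> m}. of_nat (Suc (m i) - a i) * F a = 0"
    proof
      fix a assume a: "a \<in> {a. a \<le> m'} - {a. a \<le> m}"
      then have "\<And>l. l \<noteq> i \<Longrightarrow> a l \<le> m l"
        by (auto simp: m'_def le_fun_def split: if_splits)
      with a have "\<not> a i \<le> m i"
        by (auto simp: le_fun_def) metis
      then have "Suc (m i) - a i = 0"
        by simp
      then show "of_nat (Suc (m i) - a i) * F a = 0"
        by simp
    qed
  qed simp
  also have "\<dots> = mfps_nth (f * mfps_deriv i g) m"
    unfolding mfps_nth_mult
  proof (rule sum.cong[OF HOL.refl])
    fix a assume "a \<in> {a. a \<le> m}"
    then have le: "a l \<le> m l" for l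
      by (auto simp: le_fun_def)
    have "m' - a = (m - a)(i := Suc ((m - a) i))"
      using le[of i] by (auto simp: m'_def fun_eq_iff)
    moreover have "Suc (m i) - a i = Suc ((m - a) i)"
      using le[of i] by simp
    ultimately show "of_nat (Suc (m i) - a i) * F a = mfps_nth f a * mfps_nth (mfps_deriv i g) (m - a)"
      by (simp add: F_def mult.left_commute)
  qed
  finally show "mfps_nth (mfps_deriv i (f * g)) m = mfps_nth (mfps_deriv i f * g + f * mfps_deriv i g) m"
    by simp
qed

section \<open>Restriction to the subspaces where all variables of index below i vanish\<close>

definition supported_above :: "'n::linorder \<Rightarrow> ('n \<Rightarrow> nat) \<Rightarrow> bool" where
  "supported_above i m \<longleftrightarrow> (\<forall>l. m l \<noteq> 0 \<longrightarrow> i \<le> l)"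

text \<open>The ideal generated by the variables \<open>x\<^sub>l\<close> with \<open>l < i\<close>.\<close>

definition lower_ideal :: "'n::linorder \<Rightarrow> ('a::zero, 'n) mfps set" where
  "lower_ideal i = {p. \<forall>m. supported_above i m \<longrightarrow> mfps_nth p m = 0}"

lemma supported_above_diff: "supported_above i m \<Longrightarrow> supported_above i (m - a)"
  by (fastforce simp: supported_above_def)

lemma lower_ideal_add: "p \<in> lower_ideal i \<Longrightarrow> q \<in> lower_ideal i \<Longrightarrow> p + q \<in> lower_ideal i"
  and lower_ideal_diff: "p \<in> lower_ideal i \<Longrightarrow> q \<in> lower_ideal i \<Longrightarrow> p - q \<in> lower_ideal i"
  and lower_ideal_zero: "0 \<in> lower_ideal i"
  for p q :: "('a::comm_ring_1, 'n::{finite, linorder}) mfps"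
  by (auto simp: lower_ideal_def)

lemma lower_ideal_mult_left:
  fixes p q :: "('a::comm_ring_1, 'n::{finite, linorder}) mfps"
  shows "p \<in> lower_ideal i \<Longrightarrow> q * p \<in> lower_ideal i"
  by (auto simp: lower_ideal_def mfps_nth_mult supported_above_diff intro!: sum.neutral)

lemma lower_ideal_mult_right:
  fixes p q :: "('a::comm_ring_1, 'n::{finite, linorder}) mfps"
  shows "p \<in> lower_ideal i \<Longrightarrow> p * q \<in> lower_ideal i"
  using lower_ideal_mult_left[of p i q] by (simp add: mult.commute)

lemma lower_ideal_sum_mset:
  fixes F :: "'x \<Rightarrow> ('a::comm_ring_1, 'n::{finite, linorder}) mfps"
  shows "(\<And>x. x \<in># M \<Longrightarrow> F x \<in> lower_ideal i) \<Longrightarrow> (\<Sum>x\<in>#M. F x) \<in> lower_ideal i"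
  by (induction M) (auto intro: lower_ideal_add lower_ideal_zero)

text \<open>Only derivatives along the subspace preserve vanishing on it: for j \<ge> i, raising the
  exponent of x_j keeps the support above i.\<close>

lemma lower_ideal_deriv:
  fixes p :: "('a::comm_ring_1, 'n::{finite, linorder}) mfps"
  shows "p \<in> lower_ideal i \<Longrightarrow> i \<le> j \<Longrightarrow> mfps_deriv j p \<in> lower_ideal i"
  by (auto simp: lower_ideal_def supported_above_def)

lemma least_index_nonzero:
  fixes m :: "'n::{finite, linorder} \<Rightarrow> nat"
  shows "m \<noteq> (\<lambda>i. 0) \<Longrightarrow> m (Min {l. m l \<noteq> 0}) \<noteq> 0"
  using Min_in[of "{l. m l \<noteq> 0}"] by (auto simp: fun_eq_iff)

lemma sum_exponent_decrease:
  fixes m :: "'n::finite \<Rightarrow> nat"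
  assumes "m i \<noteq> 0"
  shows "sum m UNIV = Suc (sum (m(i := m i - 1)) UNIV)"
proof -
  have "sum (m(i := m i - 1)) (UNIV - {i}) = sum m (UNIV - {i})"
    by (rule sum.cong) auto
  then show ?thesis
    using assms by (simp add: sum.remove[of UNIV i])
qed

text \<open>Take i to be the least index occurring in m. In characteristic 0 a series is therefore
  determined by its constant term and by its derivatives in x_i modulo \<open>lower_ideal i\<close>,
  for all i; inductions on the degree use this.\<close>

lemma exponent_decompose:
  fixes m :: "'n::{finite, linorder} \<Rightarrow> nat"
  assumes "m \<noteq> (\<lambda>i. 0)"
  obtains i m' where "m = m'(i := Suc (m' i))" "supported_above i m'" "sum m UNIV = Suc (sum m' UNIV)"
proof -
  define i where "i = Min {l. m l \<noteq> 0}"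
  have i: "m i \<noteq> 0"
    using least_index_nonzero[OF assms] by (simp add: i_def)
  then have "m = (m(i := m i - 1))(i := Suc ((m(i := m i - 1)) i))"
    by auto
  moreover have "supported_above i (m(i := m i - 1))"
    by (auto simp: supported_above_def i_def)
  ultimately show ?thesis
    using that sum_exponent_decrease[of m i, OF i] by blast
qed

section \<open>Evaluation of tensors\<close>

text \<open>The map \<iota> is the structure map of the target algebra: \<open>id\<close> for values
  in k, \<open>mfps_const\<close> for values in power series. One notion thus serves for a series
  and for its coefficients.\<close>

definition lin :: "('k \<Rightarrow> 'r::comm_ring_1) \<Rightarrow> ('k \<Rightarrow> 'h \<Rightarrow> 'h::comm_ring_1) \<Rightarrow> ('h \<Rightarrow> 'r) \<Rightarrow> bool" where
  "lin \<iota> scale \<phi> \<longleftrightarrow> (\<forall>a b. \<phi> (a + b) = \<phi> a + \<phi> b) \<and> (\<forall>c a. \<phi> (scale c a) = \<iota> c * \<phi> a)"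

text \<open>Words of any other length evaluate to \<open>0\<close>, since a chain of relations may pass through them.\<close>

definition word_eval :: "('h \<Rightarrow> 'r) list \<Rightarrow> 'h list \<Rightarrow> 'r::comm_ring_1" where
  "word_eval \<phi>s w = (if length w = length \<phi>s then \<Prod>i<length \<phi>s. (\<phi>s ! i) (w ! i) else 0)"

text \<open>The factors at the other positions do not see the entry in this slot and form the
  constant c. The entry 0 in the auxiliary word is only a placeholder at the excluded
  position.\<close>

lemma word_eval_slot:
  fixes \<phi>s :: "('h::zero \<Rightarrow> 'r::comm_ring_1) list"
  assumes "length u + length v + 1 = length \<phi>s"
  obtains c where "\<And>a. word_eval \<phi>s (u @ [a] @ v) = c * (\<phi>s ! length u) a"
proof -
  let ?k = "length u" and ?n = "length \<phi>s"
  have "word_eval \<phi>s (u @ [a] @ v) =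
      (\<Prod>i\<in>{..<?n} - {?k}. (\<phi>s ! i) ((u @ [0] @ v) ! i)) * (\<phi>s ! ?k) a" for a
  proof -
    have "word_eval \<phi>s (u @ [a] @ v) = (\<Prod>i<?n. (\<phi>s ! i) ((u @ [a] @ v) ! i))"
      using assms by (simp add: word_eval_def)
    also have "\<dots> = (\<phi>s ! ?k) ((u @ [a] @ v) ! ?k) * (\<Prod>i\<in>{..<?n} - {?k}. (\<phi>s ! i) ((u @ [a] @ v) ! i))"
      using assms by (intro prod.remove) auto
    also have "(\<Prod>i\<in>{..<?n} - {?k}. (\<phi>s ! i) ((u @ [a] @ v) ! i)) =
        (\<Prod>i\<in>{..<?n} - {?k}. (\<phi>s ! i) ((u @ [0] @ v) ! i))"
      by (rule prod.cong) (auto simp: nth_append nth_Cons')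
    finally show ?thesis
      by (simp add: mult.commute)
  qed
  then show ?thesis
    using that by blast
qed

text \<open>A product of linear maps is multilinear, so it respects every generating relation of
  \<open>tensor_eq\<close>. This makes convolution independent of the chosen representatives of
  tensors.\<close>

lemma tensor_eq_eval:
  assumes "tensor_eq scale M N" and "\<forall>\<phi>\<in>set \<phi>s. lin \<iota> scale \<phi>"
  shows "(\<Sum>w\<in>#M. word_eval \<phi>s w) = (\<Sum>w\<in>#N. word_eval \<phi>s w)"
  using assms(1)
proof (induction rule: tensor_eq.induct)
  case (zero u v)
  show ?case
  proof (cases "length u + length v + 1 = length \<phi>s")
    case True
    then have "lin \<iota> scale (\<phi>s ! length u)"
      using assms(2) by (auto simp: all_set_conv_all_nth)
    then have "(\<phi>s ! length u) 0 = 0"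
      by (metis add_cancel_right_right lin_def)
    then show ?thesis
      using word_eval_slot[OF True] by (metis image_mset_single image_mset_empty mult_zero_right sum_mset.singleton sum_mset.empty)
  qed (simp add: word_eval_def)
next
  case (add u a b v)
  show ?case
  proof (cases "length u + length v + 1 = length \<phi>s")
    case True
    then have "lin \<iota> scale (\<phi>s ! length u)"
      using assms(2) by (auto simp: all_set_conv_all_nth)
    moreover obtain c where "\<And>a. word_eval \<phi>s (u @ [a] @ v) = c * (\<phi>s ! length u) a"
      using word_eval_slot[OF True] by blast
    ultimately show ?thesis
      by (simp add: lin_def distrib_left)
  qed (simp add: word_eval_def)
next
  case (scale u c a v b w)
  show ?case
  proof (cases "length u + length (v @ [b] @ w) + 1 = length \<phi>s")
    case True
    then have True': "length (u @ [a] @ v) + length w + 1 = length \<phi>s"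
      by simp
    have lin: "lin \<iota> scale (\<phi>s ! length u)" "lin \<iota> scale (\<phi>s ! length (u @ [a] @ v))"
      using assms(2) True by (auto simp: all_set_conv_all_nth)
    obtain p where p: "\<And>x. word_eval \<phi>s (u @ [x] @ (v @ [b] @ w)) = p * (\<phi>s ! length u) x"
      using word_eval_slot[OF True] by blast
    obtain q where q: "\<And>x. word_eval \<phi>s ((u @ [a] @ v) @ [x] @ w) = q * (\<phi>s ! length (u @ [a] @ v)) x"
      using word_eval_slot[OF True'] by blast
    \<comment> \<open>The scalar is pulled out through either of the two slots, leaving the same
      unscaled word.\<close>
    have "word_eval \<phi>s (u @ [scale c a] @ v @ [b] @ w) = \<iota> c * word_eval \<phi>s (u @ [a] @ v @ [b] @ w)"
      using lin by (simp only: p lin_def mult.left_commute)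
    moreover have "word_eval \<phi>s (u @ [a] @ v @ [scale c b] @ w) = \<iota> c * word_eval \<phi>s (u @ [a] @ v @ [b] @ w)"
      using lin q[of "scale c b"] q[of b] by (simp add: lin_def mult.left_commute)
    ultimately show ?thesis
      by simp
  qed (simp add: word_eval_def)
qed auto

lemma sum_mset_image_Sum: "(\<Sum>y\<in>#(\<Sum>x\<in>#M. F x). \<phi> y) = (\<Sum>x\<in>#M. \<Sum>y\<in>#F x. \<phi> y)"
  by (induction M) auto

lemma tensor2_eq_eval:
  assumes "tensor2_eq scale M N" "lin \<iota> scale \<phi>" "lin \<iota> scale \<psi>"
  shows "(\<Sum>(a, b)\<in>#M. \<phi> a * \<psi> b) = (\<Sum>(a, b)\<in>#N. \<phi> a * \<psi> b)"
proof -
  have "word_eval [\<phi>, \<psi>] [a, b] = \<phi> a * \<psi> b" for a b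
    by (simp add: word_eval_def lessThan_Suc)
  then show ?thesis
    using tensor_eq_eval[OF assms(1)[unfolded tensor2_eq_def], of "[\<phi>, \<psi>]" \<iota>] assms(2,3)
    by (simp add: image_mset.compositionality o_def case_prod_unfold)
qed

section \<open>The convolution algebra\<close>

lemma lin_add: "lin \<iota> scale \<phi> \<Longrightarrow> \<phi> (a + b) = \<phi> a + \<phi> b"
  and lin_scale: "lin \<iota> scale \<phi> \<Longrightarrow> \<phi> (scale c a) = \<iota> c * \<phi> a"
  by (auto simp: lin_def)

lemma lin_zero: "lin \<iota> scale \<phi> \<Longrightarrow> \<phi> 0 = 0"
  by (metis add_cancel_right_right lin_def)

lemma lin_sum_mset: "lin \<iota> scale \<phi> \<Longrightarrow> \<phi> (\<Sum>x\<in>#M. F x) = (\<Sum>x\<in>#M. \<phi> (F x))"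
  by (induction M) (auto simp: lin_add lin_zero)

lemma sum_mset_diff_distrib: "(\<Sum>x\<in>#M. f x - g x) = (\<Sum>x\<in>#M. f x) - (\<Sum>x\<in>#M. g x :: 'a::ab_group_add)"
  by (induction M) auto

lemma conv_add_left: "conv comult (\<phi> + \<psi>) \<chi> = conv comult \<phi> \<chi> + conv comult \<psi> \<chi>"
  by (simp add: conv_def fun_eq_iff case_prod_unfold distrib_right sum_mset.distrib)

lemma conv_add_right: "conv comult \<chi> (\<phi> + \<psi>) = conv comult \<chi> \<phi> + conv comult \<chi> \<psi>"
  by (simp add: conv_def fun_eq_iff case_prod_unfold distrib_left sum_mset.distrib)

lemma conv_diff_left: "conv comult (\<phi> - \<psi>) \<chi> = conv comult \<phi> \<chi> - conv comult \<psi> \<chi>"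
  using conv_add_left[of comult "\<phi> - \<psi>" \<psi> \<chi>] by (simp add: algebra_simps)

lemma conv_diff_right: "conv comult \<chi> (\<phi> - \<psi>) = conv comult \<chi> \<phi> - conv comult \<chi> \<psi>"
  using conv_add_right[of comult \<chi> "\<phi> - \<psi>" \<psi>] by (simp add: algebra_simps)

lemma conv_times_conv:
  "conv comult \<phi> \<psi> f * conv comult \<phi>' \<psi>' g =
     (\<Sum>(a, b)\<in>#comult f. \<Sum>(a', b')\<in>#comult g. (\<phi> a * \<phi>' a') * (\<psi> b * \<psi>' b'))"
  by (simp add: conv_def sum_mset_distrib_left sum_mset_distrib_right case_prod_unfold mult_ac)
    (rule sum_mset.swap)

text \<open>This gives the coefficients of A_i g the form of the sums in the recursion for
  \<open>axial_gauge_coeff\<close>.\<close>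

lemma mfps_nth_conv:
  "mfps_nth (conv comult \<phi> \<psi> f) m = (\<Sum>a | a \<le> m. conv comult (coefficient \<phi> a) (coefficient \<psi> (m - a)) f)"
proof -
  have "(\<Sum>x\<in>#M. \<Sum>a\<in>A. F x a) = (\<Sum>a\<in>A. \<Sum>x\<in>#M. F x a)" for M A and F :: "'z \<Rightarrow> 'y \<Rightarrow> 'x::comm_monoid_add"
    by (induction M) (auto simp: sum.distrib)
  then show ?thesis
    by (simp add: conv_def coefficient_def case_prod_unfold mfps_nth_mult image_mset.compositionality o_def)
qed

lemma partial_add: "partial i (\<phi> + \<psi>) = partial i \<phi> + partial i (\<psi> :: 'h \<Rightarrow> ('a::comm_ring_1, 'n::finite) mfps)"
  by (simp add: partial_def fun_eq_iff)

lemma partial_commute: "partial i (partial j \<phi>) = partial j (partial i (\<phi> :: 'h \<Rightarrow> ('a::comm_ring_1, 'n::finite) mfps))"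
  by (simp add: partial_def fun_eq_iff mfps_deriv_commute)

lemma partial_conv:
  "partial i (conv comult \<phi> \<psi>) =
     conv comult (partial i \<phi>) \<psi> + conv comult \<phi> (partial i (\<psi> :: 'h \<Rightarrow> ('a::comm_ring_1, 'n::finite) mfps))"
  by (simp add: partial_def fun_eq_iff conv_def mfps_deriv_sum_mset mfps_deriv_mult case_prod_unfold
      image_mset.compositionality o_def sum_mset.distrib)

lemma value_at_0_conv:
  "value_at_0 (conv comult \<phi> (\<psi> :: 'h \<Rightarrow> ('a::comm_ring_1, 'n::finite) mfps)) = conv comult (value_at_0 \<phi>) (value_at_0 \<psi>)"
  by (simp add: value_at_0_def coefficient_def fun_eq_iff conv_def case_prod_unfold mfps_nth_mult_0
      image_mset.compositionality o_def)

lemma vector_space_mfps_scale: "vector_space (mfps_scale :: 'k::field \<Rightarrow> _ \<Rightarrow> ('k, 'n::finite) mfps)"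
  by standard (simp_all add: mfps_scale_def mfps_const_add mfps_const_mult algebra_simps)

context affine_algebraic_group
begin

abbreviation cv :: "('h \<Rightarrow> 'r) \<Rightarrow> ('h \<Rightarrow> 'r) \<Rightarrow> 'h \<Rightarrow> 'r::comm_ring_1" (infixl \<open>\<star>\<close> 70) where
  "\<phi> \<star> \<psi> \<equiv> conv comult \<phi> \<psi>"

abbreviation linear_map :: "('h \<Rightarrow> ('k, 'n::finite) mfps) \<Rightarrow> bool" where
  "linear_map \<equiv> lin mfps_const scale"

text \<open>The unit of the convolution algebra over power series, hence the identity of the gauge
  group.\<close>

definition eps :: "'h \<Rightarrow> ('k, 'n::finite) mfps" where
  "eps f = mfps_const (counit f)"

lemma counit_simps:
  "counit (a + b) = counit a + counit b" "counit (scale c a) = c * counit a"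
  "counit (a * b) = counit a * counit b" "counit 1 = 1"
  using counit_hom by (auto simp: algebra_hom_def Vector_Spaces.linear_iff)

lemma antipode_simps:
  "antipode (a + b) = antipode a + antipode b" "antipode (scale c a) = scale c (antipode a)"
  "antipode (a * b) = antipode a * antipode b" "antipode 1 = 1"
  using antipode_hom by (auto simp: algebra_hom_def Vector_Spaces.linear_iff)

lemma lin_conv:
  assumes "lin \<iota> scale \<phi>" "lin \<iota> scale \<psi>"
  shows "lin \<iota> scale (\<phi> \<star> \<psi>)"
  unfolding lin_def
proof safe
  fix a b c
  show "(\<phi> \<star> \<psi>) (a + b) = (\<phi> \<star> \<psi>) a + (\<phi> \<star> \<psi>) b"
    using tensor2_eq_eval[OF comult_add assms] by (simp add: conv_def)
  show "(\<phi> \<star> \<psi>) (scale c a) = \<iota> c * (\<phi> \<star> \<psi>) a"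
    using tensor2_eq_eval[OF comult_scale assms] assms(1)
    by (simp add: conv_def case_prod_unfold image_mset.compositionality o_def lin_scale mult.assoc
        sum_mset_distrib_left)
qed

text \<open>Coassociativity is evaluated at the three maps. Linearity enters because the axiom holds
  only up to equality of tensors.\<close>

lemma conv_assoc:
  assumes "lin \<iota> scale \<phi>" "lin \<iota> scale \<psi>" "lin \<iota> scale \<chi>"
  shows "\<phi> \<star> \<psi> \<star> \<chi> = \<phi> \<star> (\<psi> \<star> \<chi>)"
proof
  fix f
  have eval: "word_eval [\<phi>, \<psi>, \<chi>] [a, b, c] = \<phi> a * \<psi> b * \<chi> c" for a b c
    by (simp add: word_eval_def lessThan_Suc mult_ac)
  show "(\<phi> \<star> \<psi> \<star> \<chi>) f = (\<phi> \<star> (\<psi> \<star> \<chi>)) f"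
    using tensor_eq_eval[OF coassoc, of "[\<phi>, \<psi>, \<chi>]" \<iota> f] assms
    by (simp add: conv_def sum_mset_image_Sum case_prod_unfold image_mset.compositionality o_def eval
        sum_mset_distrib_left sum_mset_distrib_right mult.assoc)
qed

lemma eps_conv: "linear_map \<phi> \<Longrightarrow> eps \<star> \<phi> = \<phi>"
proof
  fix f assume "lin mfps_const scale \<phi>"
  then show "(eps \<star> \<phi>) f = \<phi> f"
    using lin_sum_mset[of mfps_const scale \<phi> "\<lambda>(a, b). scale (counit a) b" "comult f"] counit_left[of f]
    by (simp add: conv_def eps_def case_prod_unfold lin_scale[of mfps_const] mult.commute)
qed

lemma conv_eps: "linear_map \<phi> \<Longrightarrow> \<phi> \<star> eps = \<phi>"
proof
  fix f assume "lin mfps_const scale \<phi>"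
  then show "(\<phi> \<star> eps) f = \<phi> f"
    using lin_sum_mset[of mfps_const scale \<phi> "\<lambda>(a, b). scale (counit b) a" "comult f"] counit_right[of f]
    by (simp add: conv_def eps_def case_prod_unfold lin_scale[of mfps_const] mult.commute)
qed

lemma counit_conv: "lin id scale X \<Longrightarrow> counit \<star> X = X"
proof
  fix f assume "lin id scale X"
  then show "(counit \<star> X) f = X f"
    using lin_sum_mset[of id scale X "\<lambda>(a, b). scale (counit a) b" "comult f"] counit_left[of f]
    by (simp add: conv_def case_prod_unfold lin_scale[of id] mult.commute)
qed

lemma conv_counit: "lin id scale X \<Longrightarrow> X \<star> counit = X"
proof
  fix f assume "lin id scale X"
  then show "(X \<star> counit) f = X f"
    using lin_sum_mset[of id scale X "\<lambda>(a, b). scale (counit b) a" "comult f"] counit_right[of f]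
    by (simp add: conv_def case_prod_unfold lin_scale[of id] mult.commute)
qed

text \<open>Combined with \<open>conv_times_conv\<close>, this reduces product rules for a
  convolution to product rules for its two factors inside each summand.\<close>

lemma conv_mult:
  assumes "lin \<iota> scale \<phi>" "lin \<iota> scale \<psi>"
  shows "(\<phi> \<star> \<psi>) (f * g) = (\<Sum>(a, b)\<in>#comult f. \<Sum>(a', b')\<in>#comult g. \<phi> (a * a') * \<psi> (b * b'))"
  using tensor2_eq_eval[OF comult_mult assms]
  by (simp add: conv_def sum_mset_image_Sum case_prod_unfold image_mset.compositionality o_def)

lemma conv_one:
  assumes "lin \<iota> scale \<phi>" "lin \<iota> scale \<psi>"
  shows "(\<phi> \<star> \<psi>) 1 = \<phi> 1 * \<psi> 1"
  using tensor2_eq_eval[OF comult_one assms] by (simp add: conv_def)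

lemma linear_map_add: "linear_map \<phi> \<Longrightarrow> linear_map \<psi> \<Longrightarrow> linear_map (\<phi> + \<psi>)"
  by (simp add: lin_def distrib_left add_ac)

lemma linear_map_diff: "linear_map \<phi> \<Longrightarrow> linear_map \<psi> \<Longrightarrow> linear_map (\<phi> - \<psi>)"
  by (simp add: lin_def right_diff_distrib)

lemma linear_map_partial: "linear_map \<phi> \<Longrightarrow> linear_map (partial i \<phi>)"
  by (simp add: lin_def partial_def mfps_deriv_mult)

lemma linear_map_iff_coefficient: "linear_map \<phi> \<longleftrightarrow> (\<forall>m. lin id scale (coefficient \<phi> m))"
  by (auto simp: lin_def coefficient_def intro!: mfps_eqI)

lemma linear_map_antipode: "linear_map \<phi> \<Longrightarrow> linear_map (\<phi> \<circ> antipode)"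
  by (simp add: lin_def antipode_simps)

lemma linear_map_times:
  "linear_map \<phi> \<Longrightarrow> linear_map (\<lambda>a. \<phi> (a * b))" "linear_map \<phi> \<Longrightarrow> linear_map (\<lambda>b. \<phi> (a * b))"
  by (auto simp: lin_def distrib_left distrib_right scale_mult mult.commute[of _ "scale _ _"])
    (simp add: mult.commute)

text \<open>Since \<open>eps\<close> takes constant values, the derivation conditions on the
  separate coefficients assemble into one Leibniz rule over the power series ring.\<close>

lemma lie_series_iff:
  "B \<in> lie_series scale counit \<longleftrightarrow> linear_map B \<and> (\<forall>a b. B (a * b) = B a * eps b + eps a * B b)"
proof -
  have lin: "Vector_Spaces.linear scale (*) X \<longleftrightarrow> lin id scale X" for X
    using vector_space_axioms by (auto simp: Vector_Spaces.linear_iff lin_def vector_space_def algebra_simps)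
  have "B (a * b) = B a * eps b + eps a * B b \<longleftrightarrow>
      (\<forall>m. coefficient B m (a * b) = coefficient B m a * counit b + counit a * coefficient B m b)" for a b
    by (auto simp: coefficient_def eps_def mult.commute[of _ "mfps_const _"] mult.commute[of _ "counit b"]
        intro!: mfps_eqI)
  then show ?thesis
    by (auto simp: lie_series_def lie_algebra_def lin linear_map_iff_coefficient)
qed

lemma gauge_group_iff:
  "g \<in> gauge_group scale \<longleftrightarrow> linear_map g \<and> g 1 = 1 \<and> (\<forall>a b. g (a * b) = g a * g b)"
  using vector_space_axioms vector_space_mfps_scale
  by (auto simp: gauge_group_def algebra_hom_def Vector_Spaces.linear_iff lin_def mfps_scale_def)

section \<open>Gauge transformations\<close>

text \<open>As g is linear and multiplicative, the whole sum can be taken inside g, where the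
  antipode axiom applies.\<close>

lemma antipode_conv: "g \<in> gauge_group scale \<Longrightarrow> (g \<circ> antipode) \<star> g = eps"
proof
  fix f assume "g \<in> gauge_group scale"
  then have "((g \<circ> antipode) \<star> g) f = g (\<Sum>(a, b)\<in>#comult f. antipode a * b)"
    using lin_sum_mset[of mfps_const scale g "\<lambda>(a, b). antipode a * b"]
    by (simp add: gauge_group_iff conv_def case_prod_unfold)
  then show "((g \<circ> antipode) \<star> g) f = eps f"
    using \<open>g \<in> _\<close> by (simp add: antipode_left gauge_group_iff lin_scale[of mfps_const] eps_def)
qed

lemma conv_antipode: "g \<in> gauge_group scale \<Longrightarrow> g \<star> (g \<circ> antipode) = eps"
proof
  fix f assume "g \<in> gauge_group scale"
  then have "(g \<star> (g \<circ> antipode)) f = g (\<Sum>(a, b)\<in>#comult f. a * antipode b)"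
    using lin_sum_mset[of mfps_const scale g "\<lambda>(a, b). a * antipode b"]
    by (simp add: gauge_group_iff conv_def case_prod_unfold)
  then show "(g \<star> (g \<circ> antipode)) f = eps f"
    using \<open>g \<in> _\<close> by (simp add: antipode_right gauge_group_iff lin_scale[of mfps_const] eps_def)
qed

lemma gauge_group_antipode: "g \<in> gauge_group scale \<Longrightarrow> g \<circ> antipode \<in> gauge_group scale"
  by (auto simp: gauge_group_iff linear_map_antipode antipode_simps)

text \<open>Comultiplication is multiplicative and the target ring is commutative, so the factors
  from g and h can be regrouped.\<close>

lemma gauge_group_conv:
  assumes "g \<in> gauge_group scale" "h \<in> gauge_group scale"
  shows "g \<star> h \<in> gauge_group scale"
  unfolding gauge_group_iff
proof safe
  note gh = assms[unfolded gauge_group_iff]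
  show "linear_map (g \<star> h)" "(g \<star> h) 1 = 1"
    using gh by (auto simp: lin_conv conv_one)
  fix a b
  show "(g \<star> h) (a * b) = (g \<star> h) a * (g \<star> h) b"
    using gh by (simp add: conv_mult[of mfps_const] conv_times_conv)
qed

lemma gauge_transform_eq:
  assumes "g \<in> gauge_group scale" "linear_map (A i)"
  shows "gauge_transform comult antipode g A i = (g \<circ> antipode) \<star> (A i \<star> g + partial i g)"
proof -
  have "linear_map g" "linear_map (g \<circ> antipode)"
    using assms(1) gauge_group_antipode[OF assms(1)] by (auto simp: gauge_group_iff)
  then show ?thesis
    using conv_assoc[of mfps_const "g \<circ> antipode" "A i" g] assms(2)
    by (simp add: gauge_transform_def fun_eq_iff conv_add_right)
qed

text \<open>Multiplying by g on the left removes the inverse. The gauge relation is used below in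
  this form, g A' = A g + dg.\<close>

lemma gauge_transform_iff:
  assumes "g \<in> gauge_group scale" "\<And>i. linear_map (A i)" "\<And>i. linear_map (A' i)"
  shows "A' = gauge_transform comult antipode g A \<longleftrightarrow> (\<forall>i. g \<star> A' i = A i \<star> g + partial i g)"
proof -
  define h where "h = g \<circ> antipode"
  have g: "linear_map g" and h: "linear_map h"
    using assms(1) gauge_group_antipode[OF assms(1)] by (auto simp: gauge_group_iff h_def)
  have gh: "g \<star> h = eps" "h \<star> g = eps"
    by (simp_all add: h_def assms(1) conv_antipode antipode_conv)
  have B: "linear_map (A i \<star> g + partial i g)" for i
    by (intro linear_map_add lin_conv linear_map_partial assms g)
  have "A' i = h \<star> (A i \<star> g + partial i g) \<longleftrightarrow> g \<star> A' i = A i \<star> g + partial i g" for i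
    by (metis conv_assoc[OF g h B] conv_assoc[OF h g assms(3)] gh eps_conv B assms(3))
  then show ?thesis
    by (auto simp: fun_eq_iff[of A'] gauge_transform_eq[OF assms(1,2)] h_def)
qed

text \<open>The Leibniz rule for A splits the double sum in two, and in each half the counit law
  collapses one comultiplication. Taking g merely linear lets this apply to
  \<open>axial_gauge\<close> before its multiplicativity is known.\<close>

lemma conv_lie_mult:
  assumes A: "A \<in> lie_series scale counit" and g: "linear_map g"
  shows "(A \<star> g) (a * b) = (\<Sum>(p, q)\<in>#comult a. A p * g (q * b)) + (\<Sum>(p, q)\<in>#comult b. A p * g (a * q))"
proof -
  note A' = A[unfolded lie_series_iff]
  \<comment> \<open>With one factor fixed, g of a product is linear in the other, so convolving with
    \<open>eps\<close> leaves it unchanged.\<close>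
  have "g (q * b) = (eps \<star> (\<lambda>x. g (q * x))) b" "g (a * q) = (eps \<star> (\<lambda>x. g (x * q))) a" for q
    by (simp_all add: eps_conv linear_map_times g)
  then have inner: "g (q * b) = (\<Sum>x\<in>#comult b. eps (fst x) * g (q * snd x))"
    "g (a * q) = (\<Sum>x\<in>#comult a. eps (fst x) * g (snd x * q))" for q
    by (simp_all add: conv_def case_prod_unfold)
  have "(A \<star> g) (a * b) = (\<Sum>x\<in>#comult a. \<Sum>y\<in>#comult b. A (fst x) * (eps (fst y) * g (snd x * snd y)))
      + (\<Sum>x\<in>#comult a. \<Sum>y\<in>#comult b. A (fst y) * (eps (fst x) * g (snd x * snd y)))"
    using A' g by (simp add: conv_mult[of mfps_const] case_prod_unfold sum_mset.distrib algebra_simps)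
  also have "(\<Sum>x\<in>#comult a. \<Sum>y\<in>#comult b. A (fst y) * (eps (fst x) * g (snd x * snd y))) =
      (\<Sum>y\<in>#comult b. \<Sum>x\<in>#comult a. A (fst y) * (eps (fst x) * g (snd x * snd y)))"
    by (rule sum_mset.swap)
  finally show ?thesis
    by (simp add: inner case_prod_unfold sum_mset_distrib_left)
qed

text \<open>The series B = A_i g + (derivative of g) is a derivation along g, that is, a tangent
  vector at g. Convolving with the inverse h translates it to the identity: h g = \<open>eps\<close>
  turns the rule along g into the rule along \<open>eps\<close>.\<close>

lemma gauge_transform_connections:
  assumes A: "A \<in> connections scale counit" and g: "g \<in> gauge_group scale"
  shows "gauge_transform comult antipode g A \<in> connections scale counit"
  unfolding connections_def
proof safe
  fix i
  define B where "B = A i \<star> g + partial i g"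
  define h where "h = g \<circ> antipode"
  note g' = g[unfolded gauge_group_iff]
  have Ai: "A i \<in> lie_series scale counit"
    using A by (simp add: connections_def)
  have h: "linear_map h" "h (a * b) = h a * h b" for a b
    using gauge_group_antipode[OF g] by (auto simp: gauge_group_iff h_def)
  have hg: "h \<star> g = eps"
    by (simp add: h_def g antipode_conv)
  have B: "linear_map B"
    using Ai g' by (auto simp: B_def lie_series_iff intro!: linear_map_add lin_conv linear_map_partial)
  have B_mult: "B (a * b) = B a * g b + g a * B b" for a b
    using g' by (simp add: B_def partial_def mfps_deriv_mult conv_lie_mult[OF Ai] algebra_simps)
      (simp add: conv_def case_prod_unfold sum_mset_distrib_left sum_mset_distrib_right mult_ac)
  have "(h \<star> B) (a * b) = (h \<star> B) a * eps b + eps a * (h \<star> B) b" for a b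
    using h B by (simp add: conv_mult[of mfps_const] conv_times_conv hg[symmetric] B_mult distrib_left
        case_prod_unfold sum_mset.distrib)
  moreover have "gauge_transform comult antipode g A i = h \<star> B"
    using gauge_transform_eq[OF g] Ai by (simp add: h_def B_def lie_series_iff)
  ultimately show "gauge_transform comult antipode g A i \<in> lie_series scale counit"
    by (simp add: lie_series_iff lin_conv h B)
qed

section \<open>Gauge covariance of the curvature and its covariant derivatives\<close>

lemma covariant_deriv_eq: "covariant_deriv comult A i B = partial i B + (A i \<star> B - B \<star> A i)"
  by (simp add: covariant_deriv_def lie_bracket_def fun_eq_iff)

lemma curvature_eq: "curvature comult A i j = partial i (A j) - partial j (A i) + (A i \<star> A j - A j \<star> A i)"
  by (simp add: curvature_def lie_bracket_def fun_eq_iff)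

lemma linear_map_covariant_deriv:
  "linear_map (A i) \<Longrightarrow> linear_map B \<Longrightarrow> linear_map (covariant_deriv comult A i B)"
  unfolding covariant_deriv_eq by (intro linear_map_add linear_map_diff lin_conv linear_map_partial)

lemma linear_map_curvature:
  "linear_map (A i) \<Longrightarrow> linear_map (A j) \<Longrightarrow> linear_map (curvature comult A i j)"
  unfolding curvature_eq by (intro linear_map_add linear_map_diff lin_conv linear_map_partial)

text \<open>Conjugacy of B and B' is written as g B' = B g. Differentiating this produces (dg) B'
  and B (dg), which cancel against the inhomogeneous terms that A' contributes to the
  commutator.\<close>

lemma covariant_deriv_intertwine:
  assumes lin: "linear_map g" "linear_map (A i)" "linear_map (A' i)" "linear_map B" "linear_map B'"
    and A: "g \<star> A' i = A i \<star> g + partial i g" and B: "g \<star> B' = B \<star> g"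
  shows "g \<star> covariant_deriv comult A' i B' = covariant_deriv comult A i B \<star> g"
proof -
  note assoc = conv_assoc[of mfps_const]
  have "partial i (g \<star> B') = partial i (B \<star> g)"
    by (simp only: B)
  then have "partial i g \<star> B' + g \<star> partial i B' = partial i B \<star> g + B \<star> partial i g"
    by (simp only: partial_conv)
  moreover have "g \<star> (A' i \<star> B') = A i \<star> (B \<star> g) + partial i g \<star> B'"
  proof -
    have "g \<star> (A' i \<star> B') = (A i \<star> g + partial i g) \<star> B'"
      by (simp only: A lin flip: assoc)
    also have "\<dots> = A i \<star> (g \<star> B') + partial i g \<star> B'"
      by (simp only: conv_add_left assoc lin)
    finally show ?thesis
      by (simp only: B)
  qed
  moreover have "g \<star> (B' \<star> A' i) = B \<star> (A i \<star> g) + B \<star> partial i g"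
  proof -
    have "g \<star> (B' \<star> A' i) = B \<star> g \<star> A' i"
      by (simp only: B lin flip: assoc)
    also have "\<dots> = B \<star> (g \<star> A' i)"
      by (simp only: assoc lin)
    finally show ?thesis
      by (simp only: A conv_add_right)
  qed
  moreover have "A i \<star> (B \<star> g) = A i \<star> B \<star> g" "B \<star> (A i \<star> g) = B \<star> A i \<star> g"
    by (simp_all only: assoc lin)
  ultimately show ?thesis
    by (simp add: covariant_deriv_eq conv_add_left conv_add_right conv_diff_left conv_diff_right algebra_simps)
qed

text \<open>Second derivatives of g cancel because partial derivatives commute; the terms with one
  derivative of g cancel between the linear and the quadratic part of the curvature.\<close>

lemma curvature_intertwine:
  assumes lin: "linear_map g" "\<And>i. linear_map (A i)" "\<And>i. linear_map (A' i)"
    and A: "\<And>i. g \<star> A' i = A i \<star> g + partial i g"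
  shows "g \<star> curvature comult A' i j = curvature comult A i j \<star> g"
proof -
  have deriv: "g \<star> partial i (A' j) =
      partial i (A j) \<star> g + A j \<star> partial i g + partial i (partial j g) - partial i g \<star> A' j" for i j
  proof -
    have "partial i (g \<star> A' j) = partial i (A j \<star> g + partial j g)"
      by (simp only: A)
    then show ?thesis
      by (simp add: partial_conv partial_add eq_diff_eq add_ac)
  qed
  have quad: "g \<star> (A' i \<star> A' j) = A i \<star> A j \<star> g + A i \<star> partial j g + partial i g \<star> A' j" for i j
  proof -
    note assoc = conv_assoc[of mfps_const]
    have "g \<star> (A' i \<star> A' j) = (A i \<star> g + partial i g) \<star> A' j"
      by (simp only: A lin flip: assoc)
    also have "\<dots> = A i \<star> (g \<star> A' j) + partial i g \<star> A' j"
      by (simp only: conv_add_left assoc lin)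
    finally show ?thesis
      by (simp only: A conv_add_right assoc lin)
  qed
  show ?thesis
    unfolding curvature_eq conv_add_left conv_add_right conv_diff_left conv_diff_right deriv quad
    by (simp add: partial_commute[of i j g] algebra_simps)
qed

text \<open>Induction along the word shows that g intertwines the iterated covariant derivatives. At
  0 a restricted g is the convolution unit, so conjugation by it disappears.\<close>

lemma curvature_jet_invariant:
  fixes A A' :: "'n::finite \<Rightarrow> 'h \<Rightarrow> ('k, 'n) mfps"
  assumes lin: "linear_map g" "\<And>i. linear_map (A i)" "\<And>i. linear_map (A' i)"
    and A: "\<And>i. g \<star> A' i = A i \<star> g + partial i g" and g0: "value_at_0 g = counit"
  shows "curvature_jet comult A' I = curvature_jet comult A I"
proof -
  let ?F = "\<lambda>A. curvature comult A (I ! (length I - 2)) (I ! (length I - 1))"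
  define B where "B A L = foldr (covariant_deriv comult A) L (?F A)" for A :: "'n \<Rightarrow> 'h \<Rightarrow> ('k, 'n) mfps" and L
  have "linear_map (B A L) \<and> linear_map (B A' L) \<and> g \<star> B A' L = B A L \<star> g" for L
    by (induction L)
      (simp_all add: B_def lin A linear_map_curvature curvature_intertwine linear_map_covariant_deriv
        covariant_deriv_intertwine)
  then have *: "linear_map (B A L)" "linear_map (B A' L)" "g \<star> B A' L = B A L \<star> g" for L
    by auto
  have "lin id scale (value_at_0 (B A L))" "lin id scale (value_at_0 (B A' L))" for L
    using *(1,2)[of L] by (simp_all add: linear_map_iff_coefficient value_at_0_def)
  then have "value_at_0 (B A' L) = value_at_0 (B A L)" for L
    using arg_cong[OF *(3)[of L], of value_at_0]
    by (simp add: value_at_0_conv g0 counit_conv conv_counit)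
  then show ?thesis
    by (simp add: curvature_jet_def Let_def B_def)
qed

text \<open>If g takes A to B and g' takes A' to B, then g times the inverse of g' takes A to
  A'.\<close>

lemma gauge_equivalent_if_common_transform:
  assumes lin: "\<And>i. linear_map (A i)" "\<And>i. linear_map (A' i)" "\<And>i. linear_map (B i)"
    and g: "g \<in> gauge_group scale" "value_at_0 g = counit" "\<And>i. g \<star> B i = A i \<star> g + partial i g"
    and g': "g' \<in> gauge_group scale" "value_at_0 g' = counit" "\<And>i. g' \<star> B i = A' i \<star> g' + partial i g'"
  shows "restricted_gauge_equivalent scale comult counit antipode A A'"
proof -
  define h where "h = g' \<circ> antipode"
  have hG: "h \<in> gauge_group scale" and ghG: "g \<star> h \<in> gauge_group scale"
    by (simp_all add: h_def gauge_group_antipode gauge_group_conv g g')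
  have l: "linear_map g" "linear_map g'" "linear_map h"
    using g g' hG by (auto simp: gauge_group_iff)
  note assoc = conv_assoc[of mfps_const]
  have e: "g' \<star> h = eps" "h \<star> g' = eps"
    by (simp_all add: h_def g' antipode_conv conv_antipode)
  \<comment> \<open>The derivative of the constant series g' h = \<open>eps\<close>.\<close>
  have dgh: "partial i g' \<star> h + g' \<star> partial i h = 0" for i
    using arg_cong[OF e(1), of "partial i"] by (simp add: partial_conv) (simp add: partial_def eps_def fun_eq_iff)
  \<comment> \<open>The inverse h carries B back to A': insert h g' = \<open>eps\<close> in front of
    B_i h, rewrite g' B_i by the gauge relation, and trade (dg') h for -g' (dh).\<close>
  have h': "h \<star> A' i = B i \<star> h + partial i h" for i
  proof -
    have d: "linear_map (partial i g')" "linear_map (partial i h)"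
      by (simp_all add: linear_map_partial l)
    have "B i \<star> h = h \<star> (g' \<star> B i \<star> h)"
      by (simp add: assoc lin l lin_conv eps_conv e(2) flip: assoc[of h g'])
    also have "g' \<star> B i \<star> h = A' i \<star> g' \<star> h - g' \<star> partial i h"
      using dgh[of i] by (simp add: g'(3) conv_add_left eq_neg_iff_add_eq_0)
    also have "A' i \<star> g' \<star> h = A' i"
      by (simp add: assoc lin l conv_eps e(1))
    also have "h \<star> (A' i - g' \<star> partial i h) = h \<star> A' i - partial i h"
      by (simp add: conv_diff_right d l e(2) eps_conv flip: assoc[of h g'])
    finally show ?thesis
      by simp
  qed
  have "g \<star> h \<star> A' i = A i \<star> (g \<star> h) + partial i (g \<star> h)" for i
  proof -
    have "g \<star> h \<star> A' i = g \<star> (B i \<star> h) + g \<star> partial i h"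
      using conv_assoc[OF l(1,3) lin(2)] by (simp add: h' conv_add_right)
    also have "g \<star> (B i \<star> h) = A i \<star> (g \<star> h) + partial i g \<star> h"
    proof -
      have "g \<star> (B i \<star> h) = g \<star> B i \<star> h"
        by (simp only: assoc lin l)
      then show ?thesis
        by (simp only: g(3) conv_add_left assoc lin l)
    qed
    finally show ?thesis
      by (simp add: partial_conv fun_eq_iff add_ac)
  qed
  moreover have "value_at_0 (g \<star> h) = counit"
  proof -
    \<comment> \<open>Obtained by evaluating g' h = \<open>eps\<close> at 0, which avoids computing
      the composite of counit and antipode.\<close>
    have "counit \<star> value_at_0 h = counit"
      using arg_cong[OF e(1), of value_at_0]
      by (simp add: value_at_0_conv g'(2)) (simp add: value_at_0_def coefficient_def eps_def fun_eq_iff mfps_nth_const)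
    then show ?thesis
      by (simp add: value_at_0_conv g(2))
  qed
  ultimately show ?thesis
    unfolding restricted_gauge_equivalent_def using ghG gauge_transform_iff[of "g \<star> h" A A'] lin by blast
qed

end

section \<open>The complete axial gauge\<close>

definition axial :: "('n::linorder \<Rightarrow> 'h \<Rightarrow> ('k::zero, 'n) mfps) \<Rightarrow> bool" where
  "axial A \<longleftrightarrow> (\<forall>i f. A i f \<in> lower_ideal i)"

text \<open>The integer that iterated partial derivatives along L produce in the coefficient at m.
  For m = 0 it is the product of the factorials of the multiplicities in L.\<close>

primrec jet_factor :: "('n \<Rightarrow> nat) \<Rightarrow> 'n list \<Rightarrow> nat" where
  "jet_factor m [] = 1"
| "jet_factor m (l # L) = Suc (m l) * jet_factor (m(l := Suc (m l))) L"

lemma jet_factor_pos: "0 < jet_factor m L"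
  by (induction L arbitrary: m) auto

text \<open>The last letter is the first curvature index, whose derivative acts innermost.\<close>

lemma jet_factor_snoc: "jet_factor m (L @ [i]) = jet_factor m L * Suc (m i + count_list L i)"
  by (induction L arbitrary: m) (auto simp: algebra_simps)

lemma conv_lower_ideal:
  fixes \<phi> \<psi> :: "'h \<Rightarrow> ('k::comm_ring_1, 'n::{finite, linorder}) mfps"
  shows "(\<And>f. \<phi> f \<in> lower_ideal i) \<Longrightarrow> conv comult \<phi> \<psi> f \<in> lower_ideal i"
    and "(\<And>f. \<psi> f \<in> lower_ideal i) \<Longrightarrow> conv comult \<phi> \<psi> f \<in> lower_ideal i"
proof -
  show "conv comult \<phi> \<psi> f \<in> lower_ideal i" if "\<And>f. \<phi> f \<in> lower_ideal i"
    using that by (auto simp: conv_def case_prod_unfold intro!: lower_ideal_sum_mset lower_ideal_mult_right)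
  show "conv comult \<phi> \<psi> f \<in> lower_ideal i" if "\<And>f. \<psi> f \<in> lower_ideal i"
    using that by (auto simp: conv_def case_prod_unfold intro!: lower_ideal_sum_mset lower_ideal_mult_left)
qed

lemma lie_bracket_lower_ideal:
  fixes \<phi> \<psi> :: "'h \<Rightarrow> ('k::comm_ring_1, 'n::{finite, linorder}) mfps"
  shows "(\<And>f. \<phi> f \<in> lower_ideal i) \<Longrightarrow> lie_bracket comult \<phi> \<psi> f \<in> lower_ideal i"
  unfolding lie_bracket_def by (intro lower_ideal_diff conv_lower_ideal)

text \<open>The induction peels off the outermost derivative and passes from m to m + e_l, hence the
  general m. As L is weakly decreasing, the new exponent is still supported above every remaining
  letter, so each bracket contributes nothing.\<close>

lemma mfps_nth_covariant_derivs_axial: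
  fixes A :: "'n::{finite, linorder} \<Rightarrow> 'h \<Rightarrow> ('k::comm_ring_1, 'n) mfps"
  assumes "axial A" "sorted_wrt (\<ge>) L" "\<forall>l\<in>set L. supported_above l m"
  shows "mfps_nth (foldr (covariant_deriv comult A) L B f) m =
    of_nat (jet_factor m L) * mfps_nth (B f) (\<lambda>l. m l + count_list L l)"
  using assms(2,3)
proof (induction L arbitrary: m)
  case (Cons l L)
  define m' where "m' = m(l := Suc (m l))"
  define G where "G = foldr (covariant_deriv comult A) L B"
  have "lie_bracket comult (A l) G f \<in> lower_ideal l"
    using assms(1) by (intro lie_bracket_lower_ideal) (simp add: axial_def)
  then have "mfps_nth (covariant_deriv comult A l G f) m = of_nat (Suc (m l)) * mfps_nth (G f) m'"
    using Cons.prems by (simp add: covariant_deriv_def lower_ideal_def partial_def m'_def)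
  also have "mfps_nth (G f) m' = of_nat (jet_factor m' L) * mfps_nth (B f) (\<lambda>k. m' k + count_list L k)"
    unfolding G_def using Cons.prems
    by (intro Cons.IH) (auto simp: m'_def supported_above_def)
  also have "(\<lambda>k. m' k + count_list L k) = (\<lambda>k. m k + count_list (l # L) k)"
    by (auto simp: m'_def)
  finally show ?case
    by (simp add: G_def m'_def mult.assoc del: of_nat_Suc fun_upd_apply count_list.simps mult_Suc)
qed simp

section \<open>Admissible multi-indices and the coefficients of axial connections\<close>

lemma admissible_snoc:
  "admissible (W @ [j]) \<longleftrightarrow> W \<noteq> [] \<and> sorted_wrt (\<ge>) W \<and> last W < j"
proof (cases W rule: rev_cases)
  case (snoc L i)
  then show ?thesis
    by (simp add: admissible_def Let_def nth_append)
qed (simp add: admissible_def)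

lemma admissible_cases:
  assumes "admissible I"
  obtains W j where "I = W @ [j]" "admissible (W @ [j])"
proof (cases I rule: rev_cases)
  case Nil
  then show ?thesis
    using assms by (simp add: admissible_def)
qed (use that assms in blast)

lemma curvature_jet_axial:
  fixes A :: "'n::{finite, linorder} \<Rightarrow> 'h \<Rightarrow> ('k::comm_ring_1, 'n) mfps"
  assumes A: "axial A" and I: "admissible (W @ [j])"
  shows "curvature_jet comult A (W @ [j]) f =
    of_nat (jet_factor (\<lambda>i. 0) W) * mfps_nth (A j f) (count_list W)"
proof -
  obtain L i where W: "W = L @ [i]"
    using I[unfolded admissible_snoc] by (cases W rule: rev_cases) auto
  let ?M = "count_list L"
  have sorted: "sorted_wrt (\<ge>) L" "\<forall>l\<in>set L. i \<le> l" and ij: "i < j"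
    using I unfolding W admissible_snoc by (auto simp: sorted_wrt_append)
  then have M: "supported_above i ?M"
    by (auto simp: supported_above_def count_list_0_iff)
  \<comment> \<open>Since i < j, differentiating A_i in x_j stays in \<open>lower_ideal i\<close>.
    Of the three curvature terms only the x_i-derivative of A_j survives at exponents supported
    above i.\<close>
  have "lie_bracket comult (A i) (A j) f \<in> lower_ideal i" "partial j (A i) f \<in> lower_ideal i"
    using A ij by (auto simp: axial_def partial_def intro!: lie_bracket_lower_ideal lower_ideal_deriv)
  then have *: "mfps_nth (curvature comult A i j f) ?M = of_nat (Suc (?M i)) * mfps_nth (A j f) (?M(i := Suc (?M i)))"
    using M by (simp add: curvature_def lower_ideal_def partial_def)
  have M': "?M(i := Suc (?M i)) = count_list (L @ [i])"
    by auto
  have "curvature_jet comult A (W @ [j]) f = mfps_nth (foldr (covariant_deriv comult A) L (curvature comult A i j) f) (\<lambda>i. 0)"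
    by (simp add: curvature_jet_def W Let_def nth_append value_at_0_def coefficient_def)
  also have "\<dots> = of_nat (jet_factor (\<lambda>i. 0) L) * mfps_nth (curvature comult A i j f) ?M"
    using mfps_nth_covariant_derivs_axial[OF A sorted(1), of "\<lambda>i. 0"] by (simp add: supported_above_def)
  finally show ?thesis
    by (simp add: * W jet_factor_snoc M' algebra_simps)
qed

text \<open>Inverse to \<open>count_list\<close> on weakly decreasing words.
  \<open>Abs_multiset\<close> is meaningful at every exponent because there are finitely many
  variables.\<close>

definition descending_word :: "('n::{finite, linorder} \<Rightarrow> nat) \<Rightarrow> 'n list" where
  "descending_word m = rev (sorted_list_of_multiset (Abs_multiset m))"

lemma sorted_descending_word: "sorted_wrt (\<ge>) (descending_word m)"
  by (simp add: descending_word_def sorted_wrt_rev)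

lemma count_descending_word: "count_list (descending_word m) = m"
  by (simp add: fun_eq_iff descending_word_def flip: count_mset)

lemma descending_word_count:
  assumes "sorted_wrt (\<ge>) W"
  shows "descending_word (count_list W) = W"
proof -
  have "Abs_multiset (count_list W) = mset W"
    by (metis count_inverse count_mset ext)
  then have "descending_word (count_list W) = rev (sort (rev W))"
    unfolding descending_word_def by (metis mset_rev sorted_list_of_multiset_mset)
  also have "sort (rev W) = rev W"
    using assms by (simp add: sorted_sort_id sorted_wrt_rev)
  finally show ?thesis
    by simp
qed

text \<open>The last letter of a weakly decreasing word is its least one. Hence admissible
  multi-indices ending in j correspond exactly to the coefficients of A_j that the axial condition
  leaves free.\<close>

lemma admissible_descending_word:
  "admissible (descending_word m @ [j]) \<longleftrightarrow> \<not> supported_above j m"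
proof -
  define W where "W = descending_word m"
  have W: "sorted_wrt (\<ge>) W" and set_W: "set W = {l. m l \<noteq> 0}"
    using count_list_0_iff[of W] count_descending_word[of m]
    by (auto simp: W_def sorted_descending_word)
  have "W \<noteq> [] \<and> last W < j \<longleftrightarrow> (\<exists>l\<in>set W. l < j)"
    using W by (cases W rule: rev_cases) (auto simp: sorted_wrt_append intro: le_less_trans)
  then show ?thesis
    using W by (auto simp: admissible_snoc supported_above_def set_W not_le simp flip: W_def)
qed

text \<open>Each free coefficient is a jet divided by \<open>jet_factor\<close>, which is invertible
  in characteristic 0.\<close>

lemma axial_determined_by_jets:
  fixes A A' :: "'n::{finite, linorder} \<Rightarrow> 'h \<Rightarrow> ('k::field_char_0, 'n) mfps"
  assumes "axial A" "axial A'" "\<forall>I. admissible I \<longrightarrow> curvature_jet comult A I = curvature_jet comult A' I"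
  shows "A = A'"
proof (intro ext mfps_eqI)
  fix j f m
  show "mfps_nth (A j f) m = mfps_nth (A' j f) m"
  proof (cases "supported_above j m")
    case True
    then show ?thesis
      using assms(1,2) by (simp add: axial_def lower_ideal_def)
  next
    case False
    then have I: "admissible (descending_word m @ [j])"
      by (simp add: admissible_descending_word)
    then have "curvature_jet comult A (descending_word m @ [j]) f = curvature_jet comult A' (descending_word m @ [j]) f"
      using assms(3) by metis
    then show ?thesis
      using jet_factor_pos[of "\<lambda>i. 0" "descending_word m"]
      by (simp add: curvature_jet_axial[OF assms(1) I] curvature_jet_axial[OF assms(2) I] count_descending_word)
  qed
qed

lemma axial_with_jets_exists:
  fixes \<gamma> :: "'n::{finite, linorder} list \<Rightarrow> 'h::comm_ring_1 \<Rightarrow> 'k::field_char_0"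
  assumes scale: "vector_space scale"
    and \<gamma>: "\<forall>I. admissible I \<longrightarrow> \<gamma> I \<in> lie_algebra scale counit"
  obtains A where "A \<in> connections scale counit" "axial A"
    "\<forall>I. admissible I \<longrightarrow> curvature_jet comult A I = \<gamma> I"
proof -
  \<comment> \<open>The value 0 enforces the axial condition; the other branch solves
    \<open>curvature_jet_axial\<close> for the coefficient. Distinct admissible indices govern
    distinct coefficients, so no compatibility condition arises.\<close>
  define A where "A j f = Abs_mfps (\<lambda>m. if supported_above j m then 0
      else \<gamma> (descending_word m @ [j]) f / of_nat (jet_factor (\<lambda>i. 0) (descending_word m)))" for j f
  have A: "axial A"
    by (simp add: axial_def lower_ideal_def A_def)
  moreover have "coefficient (A j) m \<in> lie_algebra scale counit" for j m
  proof (cases "supported_above j m")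
    case True
    then show ?thesis
      using scale by (simp add: coefficient_def A_def lie_algebra_def Vector_Spaces.linear_iff vector_space_def algebra_simps)
  next
    case False
    then have "\<gamma> (descending_word m @ [j]) \<in> lie_algebra scale counit"
      using \<gamma> by (simp add: admissible_descending_word)
    then show ?thesis
      using False scale
      by (simp add: coefficient_def A_def lie_algebra_def Vector_Spaces.linear_iff vector_space_def field_simps add_divide_distrib)
  qed
  then have "A \<in> connections scale counit"
    by (simp add: connections_def lie_series_def)
  moreover have "curvature_jet comult A I = \<gamma> I" if I: "admissible I" for I
  proof -
    obtain W j where W: "I = W @ [j]" "admissible (W @ [j])"
      using I by (rule admissible_cases)
    then have "descending_word (count_list W) = W"
      by (simp add: admissible_snoc descending_word_count)
    moreover from this have "\<not> supported_above j (count_list W)"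
      by (metis W(2) admissible_descending_word)
    ultimately show ?thesis
      using jet_factor_pos[of "\<lambda>i. 0" W]
      by (auto simp: fun_eq_iff W(1) curvature_jet_axial[OF A W(2)] A_def)
  qed
  ultimately show ?thesis
    using that by blast
qed

section \<open>Transformation to the axial gauge\<close>

text \<open>Comparing coefficients in \<open>\<partial>\<^sub>i g = - A\<^sub>i g\<close> modulo the variables \<open>x\<^sub>l\<close> with \<open>l < i\<close>
  gives a recursion for the coefficients of \<open>g\<close>, where \<open>i\<close> is the least index in the exponent.\<close>

function axial_gauge_coeff ::
    "('h \<Rightarrow> ('h \<times> 'h) multiset) \<Rightarrow> ('h \<Rightarrow> 'k) \<Rightarrow>
     ('n::{finite, linorder} \<Rightarrow> 'h \<Rightarrow> ('k::field, 'n) mfps) \<Rightarrow> ('n \<Rightarrow> nat) \<Rightarrow> 'h \<Rightarrow> 'k" where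
  "axial_gauge_coeff comult counit A m =
     (if m = (\<lambda>i. 0) then counit
      else let i = Min {l. m l \<noteq> 0}; m' = m(i := m i - 1) in
        (\<lambda>f. - (\<Sum>a | a \<le> m'. conv comult (coefficient (A i) a) (axial_gauge_coeff comult counit A (m' - a)) f)
             / of_nat (m i)))"
  by pat_completeness auto
termination
proof (relation "measure (\<lambda>(_, _, A, m). sum m UNIV)")
  fix comult :: "'h \<Rightarrow> ('h \<times> 'h) multiset" and counit :: "'h \<Rightarrow> 'k::field"
    and A :: "'n::{finite, linorder} \<Rightarrow> 'h \<Rightarrow> ('k::field, 'n) mfps" and m m' a :: "'n \<Rightarrow> nat" and i
  assume m: "m \<noteq> (\<lambda>i. 0)" and i: "i = Min {l. m l \<noteq> 0}" and m': "m' = m(i := m i - 1)"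
  have "sum (m' - a) UNIV \<le> sum m' UNIV"
    by (rule sum_mono) simp
  moreover have "sum m UNIV = Suc (sum m' UNIV)"
    unfolding m' i using m by (intro sum_exponent_decrease least_index_nonzero)
  ultimately show "((comult, counit, A, m' - a), comult, counit, A, m) \<in> measure (\<lambda>(_, _, A, m). sum m UNIV)"
    by simp
qed simp

declare axial_gauge_coeff.simps [simp del]

definition axial_gauge ::
    "('h \<Rightarrow> ('h \<times> 'h) multiset) \<Rightarrow> ('h \<Rightarrow> 'k) \<Rightarrow>
     ('n::{finite, linorder} \<Rightarrow> 'h \<Rightarrow> ('k::field, 'n) mfps) \<Rightarrow> 'h \<Rightarrow> ('k, 'n) mfps" where
  "axial_gauge comult counit A f = Abs_mfps (\<lambda>m. axial_gauge_coeff comult counit A m f)"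

lemma coefficient_axial_gauge: "coefficient (axial_gauge comult counit A) m = axial_gauge_coeff comult counit A m"
  by (simp add: coefficient_def axial_gauge_def)

lemma value_at_0_axial_gauge: "value_at_0 (axial_gauge comult counit A) = counit"
  by (simp add: value_at_0_def coefficient_axial_gauge axial_gauge_coeff.simps)

text \<open>For m supported above i, the least index of m + e_i is i, so the recursion at m + e_i is
  precisely this coefficient equation. Solving the equations for all i without reducing modulo
  \<open>lower_ideal i\<close> would force the curvature to vanish.\<close>

lemma axial_gauge_equation:
  fixes A :: "'n::{finite, linorder} \<Rightarrow> 'h \<Rightarrow> ('k::field_char_0, 'n) mfps"
  shows "(conv comult (A i) (axial_gauge comult counit A) + partial i (axial_gauge comult counit A)) f \<in> lower_ideal i"
  unfolding lower_ideal_def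
proof safe
  fix m :: "'n \<Rightarrow> nat"
  assume m: "supported_above i m"
  define m' where "m' = m(i := Suc (m i))"
  have "i = Min {l. m' l \<noteq> 0}"
    using m by (intro Min_eqI[symmetric]) (auto simp: m'_def supported_above_def split: if_splits)
  moreover have "m = m'(i := m' i - 1)" "m' \<noteq> (\<lambda>i. 0)" "m' i = Suc (m i)"
    by (auto simp: m'_def fun_eq_iff)
  ultimately have "axial_gauge_coeff comult counit A m' f =
      - (\<Sum>a | a \<le> m. conv comult (coefficient (A i) a) (axial_gauge_coeff comult counit A (m - a)) f) / of_nat (Suc (m i))"
    by (subst axial_gauge_coeff.simps) (simp add: Let_def)
  then show "mfps_nth ((conv comult (A i) (axial_gauge comult counit A) + partial i (axial_gauge comult counit A)) f) m = 0"
    by (simp add: mfps_nth_conv coefficient_axial_gauge partial_def axial_gauge_def m'_def del: of_nat_Suc)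
qed

context affine_algebraic_group
begin

lemma linear_map_axial_gauge:
  assumes "\<And>i. linear_map (A i :: 'h \<Rightarrow> ('k, 'n::{finite, linorder}) mfps)"
  shows "linear_map (axial_gauge comult counit A)"
proof -
  let ?c = "axial_gauge_coeff comult counit A"
  have "lin id scale (?c m)" for m
  proof (induction "sum m UNIV" arbitrary: m rule: less_induct)
    case less
    show ?case
    proof (cases "m = (\<lambda>i. 0)")
      case True
      then show ?thesis
        by (simp add: axial_gauge_coeff.simps lin_def counit_simps)
    next
      case False
      define i where "i = Min {l. m l \<noteq> 0}"
      define m' where "m' = m(i := m i - 1)"
      have "sum m UNIV = Suc (sum m' UNIV)"
        unfolding m'_def i_def using False by (intro sum_exponent_decrease least_index_nonzero)
      moreover have "sum (m' - a) UNIV \<le> sum m' UNIV" for a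
        by (rule sum_mono) simp
      ultimately have "lin id scale (?c (m' - a))" for a
        by (intro less) (simp add: less_Suc_eq_le)
      then have "lin id scale (coefficient (A i) a \<star> ?c (m' - a))" for a
        using assms by (intro lin_conv) (simp_all add: linear_map_iff_coefficient)
      moreover have "?c m = (\<lambda>f. - (\<Sum>a | a \<le> m'. (coefficient (A i) a \<star> ?c (m' - a)) f) / of_nat (m i))"
        using False by (subst axial_gauge_coeff.simps) (simp add: Let_def i_def m'_def)
      ultimately show ?thesis
        by (simp add: lin_def sum.distrib add_divide_distrib sum_distrib_left)
    qed
  qed
  then show ?thesis
    by (simp add: linear_map_iff_coefficient coefficient_axial_gauge)
qed

end

section \<open>The solution as a group-valued series, and reduction to the axial gauge\<close>

locale affine_algebraic_group_char_0 =
  affine_algebraic_group scale comult counit antipode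
  for scale :: "'k::field_char_0 \<Rightarrow> 'h::comm_ring_1 \<Rightarrow> 'h"
    and comult counit antipode
begin

text \<open>Both \<open>g(ab)\<close> and \<open>g(a) g(b)\<close> solve the differential equation that determines \<open>g\<close>, with the
  same value at \<open>0\<close>; their difference vanishes by induction on the degree.\<close>

lemma axial_gauge_mult:
  fixes A :: "'n::{finite, linorder} \<Rightarrow> 'h \<Rightarrow> ('k, 'n) mfps"
  assumes A: "\<And>i. A i \<in> lie_series scale counit"
  defines "g \<equiv> axial_gauge comult counit A"
  shows "g (a * b) = g a * g b"
proof -
  define \<Delta> where "\<Delta> a b = g (a * b) - g a * g b" for a b
  define e where "e i = A i \<star> g + partial i g" for i
  have g: "linear_map g"
    unfolding g_def using A by (intro linear_map_axial_gauge) (simp add: lie_series_iff)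
  have e: "e i f \<in> lower_ideal i" for i f
    unfolding e_def g_def by (rule axial_gauge_equation)
  \<comment> \<open>The terms with e lie in \<open>lower_ideal i\<close>. Modulo them, \<Delta>
    satisfies a homogeneous linear equation.\<close>
  have d\<Delta>: "mfps_deriv i (\<Delta> a b) = e i (a * b) - e i a * g b - g a * e i b
      - ((\<Sum>(p, q)\<in>#comult a. A i p * \<Delta> q b) + (\<Sum>(p, q)\<in>#comult b. A i p * \<Delta> a q))" for i a b
  proof -
    have "(\<Sum>(p, q)\<in>#comult a. A i p * \<Delta> q b) = (\<Sum>(p, q)\<in>#comult a. A i p * g (q * b)) - (A i \<star> g) a * g b"
      "(\<Sum>(p, q)\<in>#comult b. A i p * \<Delta> a q) = (\<Sum>(p, q)\<in>#comult b. A i p * g (a * q)) - g a * (A i \<star> g) b"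
      by (simp_all add: \<Delta>_def conv_def case_prod_unfold sum_mset_distrib_left sum_mset_distrib_right
          right_diff_distrib sum_mset_diff_distrib mult_ac)
    then show ?thesis
      by (simp add: e_def \<Delta>_def partial_def mfps_deriv_mult conv_lie_mult[OF A g] algebra_simps)
  qed
  have "mfps_nth (\<Delta> a b) m = 0" for a b m
  \<comment> \<open>The equation for \<Delta> a b involves \<Delta> at tensor components of a and b,
    so all pairs of arguments are treated together.\<close>
  proof (induction "sum m UNIV" arbitrary: m a b rule: less_induct)
    case less
    show ?case
    proof (cases "m = (\<lambda>i. 0)")
      case True
      have "mfps_nth (g f) (\<lambda>i. 0) = counit f" for f
        using fun_cong[OF value_at_0_axial_gauge, of comult counit A f]
        by (simp add: g_def value_at_0_def coefficient_def)
      then show ?thesis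
        by (simp add: True \<Delta>_def mfps_nth_mult_0 counit_simps)
    next
      case False
      then obtain i m' where m: "m = m'(i := Suc (m' i))" and m': "supported_above i m'"
        and deg: "sum m UNIV = Suc (sum m' UNIV)"
        by (rule exponent_decompose)
      have IH: "mfps_nth (\<Delta> a b) (m' - x) = 0" for a b x
      proof (rule less)
        have "sum (m' - x) UNIV \<le> sum m' UNIV"
          by (rule sum_mono) simp
        then show "sum (m' - x) UNIV < sum m UNIV"
          by (simp add: deg)
      qed
      have "e i (a * b) - e i a * g b - g a * e i b \<in> lower_ideal i"
        by (intro lower_ideal_diff lower_ideal_mult_left lower_ideal_mult_right e)
      then have "mfps_nth (e i (a * b) - e i a * g b - g a * e i b) m' = 0"
        using m' unfolding lower_ideal_def by blast
      then have "mfps_nth (mfps_deriv i (\<Delta> a b)) m' = 0"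
        unfolding d\<Delta> by (simp add: mfps_nth_mult IH case_prod_unfold image_mset.compositionality o_def)
      then show ?thesis
        by (simp add: m del: of_nat_Suc)
    qed
  qed
  then have "\<Delta> a b = 0"
    by (intro mfps_eqI) simp
  then show ?thesis
    by (simp add: \<Delta>_def)
qed

text \<open>Derivations kill 1, so the differential equation evaluated at 1 loses its A-term and
  only the constant coefficient of g(1) remains.\<close>

lemma axial_gauge_one:
  fixes A :: "'n::{finite, linorder} \<Rightarrow> 'h \<Rightarrow> ('k, 'n) mfps"
  assumes A: "\<And>i. A i \<in> lie_series scale counit"
  defines "g \<equiv> axial_gauge comult counit A"
  shows "g 1 = 1"
proof (rule mfps_eqI)
  fix m
  have g: "linear_map g"
    unfolding g_def using A by (intro linear_map_axial_gauge) (simp add: lie_series_iff)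
  \<comment> \<open>The Leibniz rule at 1 = 1 * 1 reads A_i(1) = 2 A_i(1).\<close>
  have "A i (1 * 1) = A i 1 * eps 1 + eps 1 * A i 1" for i
    using A[unfolded lie_series_iff] by blast
  then have "A i 1 = 0" for i
    by (simp add: eps_def counit_simps)
  then have Ag: "(A i \<star> g) 1 = 0" for i
    using A g by (simp add: lie_series_iff conv_one[of mfps_const])
  show "mfps_nth (g 1) m = mfps_nth 1 m"
  proof (cases "m = (\<lambda>i. 0)")
    case True
    then show ?thesis
      using fun_cong[OF value_at_0_axial_gauge, of comult counit A 1]
      by (simp add: g_def value_at_0_def coefficient_def counit_simps mfps_nth_one)
  next
    case False
    then obtain i m' where m: "m = m'(i := Suc (m' i))" and m': "supported_above i m'"
      by (rule exponent_decompose)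
    have "(A i \<star> g + partial i g) 1 \<in> lower_ideal i"
      unfolding g_def by (rule axial_gauge_equation)
    then have "mfps_nth (g 1) m = 0"
      using m' by (simp add: Ag lower_ideal_def partial_def m del: of_nat_Suc)
    then show ?thesis
      using False by (simp add: mfps_nth_one)
  qed
qed

text \<open>By \<open>axial_gauge_equation\<close>, A_i g + (derivative of g) takes values in
  \<open>lower_ideal i\<close>; convolving with the inverse of g keeps them in this ideal.\<close>

lemma axial_transform_exists:
  fixes A :: "'n::{finite, linorder} \<Rightarrow> 'h \<Rightarrow> ('k, 'n) mfps"
  assumes A: "A \<in> connections scale counit"
  obtains g B where "g \<in> gauge_group scale" "value_at_0 g = counit" "B \<in> connections scale counit" "axial B"
    "\<And>i. g \<star> B i = A i \<star> g + partial i g"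
proof -
  define g where "g = axial_gauge comult counit A"
  define B where "B = gauge_transform comult antipode g A"
  have Ai: "A i \<in> lie_series scale counit" for i
    using A by (simp add: connections_def)
  then have lin: "linear_map (A i)" for i
    by (simp add: lie_series_iff)
  have g: "g \<in> gauge_group scale"
    using axial_gauge_mult[OF Ai] axial_gauge_one[OF Ai] linear_map_axial_gauge[of A, OF lin]
    by (simp add: gauge_group_iff g_def)
  have B: "B \<in> connections scale counit"
    unfolding B_def by (rule gauge_transform_connections[OF A g])
  have "((g \<circ> antipode) \<star> (A i \<star> g + partial i g)) f \<in> lower_ideal i" for i f
    unfolding g_def by (rule conv_lower_ideal(2), rule axial_gauge_equation)
  then have "axial B"
    by (simp only: axial_def B_def gauge_transform_eq[OF g lin]) blast
  moreover have "value_at_0 g = counit"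
    by (simp add: g_def value_at_0_axial_gauge)
  moreover have "g \<star> B i = A i \<star> g + partial i g" for i
    using gauge_transform_iff[of g A B] g lin B by (simp add: B_def connections_def lie_series_iff)
  ultimately show ?thesis
    using that g B by blast
qed

text \<open>Passing to axial representatives preserves all jets, so the two representatives coincide
  and serve as a common transform.\<close>

lemma restricted_gauge_equivalent_if_jets_eq:
  fixes A A' :: "'n::{finite, linorder} \<Rightarrow> 'h \<Rightarrow> ('k, 'n) mfps"
  assumes "A \<in> connections scale counit" "A' \<in> connections scale counit"
    and jets: "\<forall>I. admissible I \<longrightarrow> curvature_jet comult A I = curvature_jet comult A' I"
  shows "restricted_gauge_equivalent scale comult counit antipode A A'"
proof -
  have lin: "linear_map (C i)" if "C \<in> connections scale counit" for C :: "'n \<Rightarrow> 'h \<Rightarrow> ('k, 'n) mfps" and i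
    using that by (simp add: connections_def lie_series_iff)
  obtain g B where g: "g \<in> gauge_group scale" "value_at_0 g = counit" "\<And>i. g \<star> B i = A i \<star> g + partial i g"
    and B: "B \<in> connections scale counit" "axial B"
    using axial_transform_exists[OF assms(1)] by metis
  obtain g' B' where g': "g' \<in> gauge_group scale" "value_at_0 g' = counit" "\<And>i. g' \<star> B' i = A' i \<star> g' + partial i g'"
    and B': "B' \<in> connections scale counit" "axial B'"
    using axial_transform_exists[OF assms(2)] by metis
  have "curvature_jet comult B I = curvature_jet comult A I" for I
    using g assms(1) B(1) by (intro curvature_jet_invariant[of g]) (auto simp: gauge_group_iff lin)
  moreover have "curvature_jet comult B' I = curvature_jet comult A' I" for I
    using g' assms(2) B'(1) by (intro curvature_jet_invariant[of g']) (auto simp: gauge_group_iff lin)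
  ultimately have "B = B'"
    using B(2) B'(2) jets by (intro axial_determined_by_jets[of B B' comult]) simp_all
  then show ?thesis
    using gauge_equivalent_if_common_transform[of A A' B g g'] g g' lin assms(1,2) B(1) by simp
qed

end

theorem corollary4p4p5:
  fixes scale :: "'k::field_char_0 \<Rightarrow> 'h::comm_ring_1 \<Rightarrow> 'h"
    and comult :: "'h \<Rightarrow> ('h \<times> 'h) multiset"
    and counit :: "'h \<Rightarrow> 'k"
    and antipode :: "'h \<Rightarrow> 'h"
  assumes "affine_algebraic_group scale comult counit antipode"
  shows "(\<forall>A \<in> connections scale counit. \<forall>A' \<in> connections scale counit.
            (\<forall>I. admissible I \<longrightarrow> curvature_jet comult A I = curvature_jet comult A' I) \<longrightarrow>
            restricted_gauge_equivalent scale comult counit antipode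
              A (A' :: 'n::{finite, linorder} \<Rightarrow> 'h \<Rightarrow> ('k, 'n) mfps))
       \<and> (\<forall>\<gamma> :: 'n list \<Rightarrow> 'h \<Rightarrow> 'k. (\<forall>I. admissible I \<longrightarrow> \<gamma> I \<in> lie_algebra scale counit) \<longrightarrow>
            (\<exists>A \<in> connections scale counit.
               (\<forall>I. admissible I \<longrightarrow> curvature_jet comult A I = \<gamma> I) \<and>
               (\<forall>A' \<in> connections scale counit.
                  (\<forall>I. admissible I \<longrightarrow> curvature_jet comult A' I = \<gamma> I) \<longrightarrow>
                  restricted_gauge_equivalent scale comult counit antipode
                    A (A' :: 'n \<Rightarrow> 'h \<Rightarrow> ('k, 'n) mfps))))"
proof -
  interpret affine_algebraic_group_char_0 scale comult counit antipode
    using assms by (simp add: affine_algebraic_group_char_0_def)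
  show ?thesis
  proof (intro conjI allI impI)
    fix \<gamma> :: "'n list \<Rightarrow> 'h \<Rightarrow> 'k"
    assume "\<forall>I. admissible I \<longrightarrow> \<gamma> I \<in> lie_algebra scale counit"
    then obtain A :: "'n \<Rightarrow> 'h \<Rightarrow> ('k, 'n) mfps" where A: "A \<in> connections scale counit"
      and jets: "\<forall>I. admissible I \<longrightarrow> curvature_jet comult A I = \<gamma> I"
      using axial_with_jets_exists[OF vector_space_axioms] by metis
    show "\<exists>A \<in> connections scale counit.
        (\<forall>I. admissible I \<longrightarrow> curvature_jet comult A I = \<gamma> I) \<and>
        (\<forall>A' \<in> connections scale counit.
          (\<forall>I. admissible I \<longrightarrow> curvature_jet comult A' I = \<gamma> I) \<longrightarrow>
          restricted_gauge_equivalent scale comult counit antipode A (A' :: 'n \<Rightarrow> 'h \<Rightarrow> ('k, 'n) mfps))"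
      using A jets by (intro bexI[of _ A] conjI ballI impI restricted_gauge_equivalent_if_jets_eq) simp_all
  qed (blast intro: restricted_gauge_equivalent_if_jets_eq)
qed

end
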